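(* Let $k\ge 3$ be odd and let $G$ be an odd unicycle graph of girth $k$ whose Grover walk is periodic with odd period, whose unique cycle has vertices $u,u_1,\dots,u_{k-1}$ with $\deg u=4$ and $\deg u_i=2$ for $1\le i\le k-1$. Let $v_1,w_1$ be the two neighbours of $u$ off the cycle, let $t\ge1$, and suppose $v_1,\dots,v_t$ and $w_1,\dots,w_t$ are defined (as in the context) with $\deg v_1=\dots=\deg v_t=2$ and $\deg w_1=\dots=\deg w_t=2$. Then for every $1\le i\le t$: (1) $2^{2i}K_{2i}\in\mathbb{Z}$; (2) $2^{2(i-1)-1}L_{2(i-1)}(2)\in\mathbb{Z}$; (3) $2^{2(i-j)-1}L_{2(i-j)}(2,\dots,j+1)\in\mathbb{Z}$ for all $2\le j\le i-1$.
   Context: Graphs are simple, connected and finite. An odd unicycle graph is a non-bipartite graph with $|V|=|E|$, i.e. a connected graph with exactly one cycle, of odd length (its girth). Grover walk: with arcs $\mathcal{A}=\{(a,b),(b,a)\mid ab\in E\}$, $o((a,b))=a$, $t((a,b))=b$, $\overline{(a,b)}=(b,a)$, the time evolution $U$ on $\mathbb{C}^{\mathcal{A}}$ has $U_{e,f}=2/\deg t(f)$ if $t(f)=o(e)$, $e\neq\bar f$; $U_{e,f}=2/\deg t(f)-1$ if $e=\bar f$; $0$ otherwise; periodic means $U^m=I$ for some $m\ge1$, the least such $m$ being the period. Set $v_0=w_0=u$; recursively, if $v_{j-1}$ ($j\ge2$) is defined and has degree 2, $v_j$ is its neighbour other than $v_{j-2}$ (the unique vertex off the cycle side at distance $j$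 from $u$ through $v_1$); similarly for $w_j$. Put $g_j=v_{j-1}v_j$, $h_j=w_{j-1}w_j$. For an edge $e=ab$, $M(e)=\frac{1}{\deg a\deg b}$. Let $F$ be the set of edges of $G$ with no endpoint on the cycle. For $i\ge0$, $K_{2i}=\sum\prod_{l=1}^iM(e_l)$ over all $i$-matchings (sets of $i$ pairwise disjoint edges) $\{e_1,\dots,e_i\}\subseteq F$ (the empty matching contributing $1$, so $K_0=1$). For $r\ge2$, $K^g_{2i}(2,\dots,r)$ is the same sum restricted to matchings in $F\setminus\{g_2,\dots,g_r\}$, $K^h_{2i}(2,\dots,r)$ the same with $F\setminus\{h_2,\dots,h_r\}$, and $L_{2i}(2,\dots,r)=K^g_{2i}(2,\dots,r)+K^h_{2i}(2,\dots,r)$. *)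

theory Defs
  imports Complex_Main
begin

definition simple_graph :: "'a set \<Rightarrow> 'a set set \<Rightarrow> bool" where
  "simple_graph V E \<longleftrightarrow> finite V \<and>
     (\<forall>e\<in>E. \<exists>a b. e = {a, b} \<and> a \<noteq> b \<and> a \<in> V \<and> b \<in> V)"

definition adj :: "'a set set \<Rightarrow> 'a \<Rightarrow> 'a \<Rightarrow> bool" where
  "adj E a b \<longleftrightarrow> {a, b} \<in> E \<and> a \<noteq> b"

definition connected_graph :: "'a set \<Rightarrow> 'a set set \<Rightarrow> bool" where
  "connected_graph V E \<longleftrightarrow> V \<noteq> {} \<and> (\<forall>a\<in>V. \<forall>b\<in>V. (adj E)\<^sup>*\<^sup>* a b)"

definition bipartite :: "'a set \<Rightarrow> 'a set set \<Rightarrow> bool" where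
  "bipartite V E \<longleftrightarrow> (\<exists>X. X \<subseteq> V \<and> (\<forall>e\<in>E. card (e \<inter> X) = 1))"

definition deg :: "'a set set \<Rightarrow> 'a \<Rightarrow> nat" where
  "deg E a = card {b. adj E a b}"

definition odd_unicycle :: "'a set \<Rightarrow> 'a set set \<Rightarrow> bool" where
  "odd_unicycle V E \<longleftrightarrow> simple_graph V E \<and> connected_graph V E \<and>
     \<not> bipartite V E \<and> card V = card E"

definition arcs :: "'a set set \<Rightarrow> ('a \<times> 'a) set" where
  "arcs E = {(a, b). adj E a b}"

definition grover :: "'a set set \<Rightarrow> ('a \<times> 'a) \<Rightarrow> ('a \<times> 'a) \<Rightarrow> real" where
  "grover E e f =
     (if fst e = snd f then
        (if e = (snd f, fst f) then 2 / real (deg E (snd f)) - 1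
         else 2 / real (deg E (snd f)))
      else 0)"

fun grover_pow :: "'a set set \<Rightarrow> nat \<Rightarrow> ('a \<times> 'a) \<Rightarrow> ('a \<times> 'a) \<Rightarrow> real" where
  "grover_pow E 0 e f = (if e = f then 1 else 0)"
| "grover_pow E (Suc n) e f = (\<Sum>g\<in>arcs E. grover E e g * grover_pow E n g f)"

definition grover_identity_at :: "'a set set \<Rightarrow> nat \<Rightarrow> bool" where
  "grover_identity_at E m \<longleftrightarrow>
     (\<forall>e\<in>arcs E. \<forall>f\<in>arcs E. grover_pow E m e f = (if e = f then 1 else 0))"

definition grover_periodic :: "'a set set \<Rightarrow> bool" where
  "grover_periodic E \<longleftrightarrow> (\<exists>m\<ge>1. grover_identity_at E m)"

definition grover_period :: "'a set set \<Rightarrow> nat" where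
  "grover_period E = (LEAST m. m \<ge> 1 \<and> grover_identity_at E m)"

definition Mw :: "'a set set \<Rightarrow> 'a set \<Rightarrow> real" where
  "Mw E e = 1 / (\<Prod>x\<in>e. real (deg E x))"

definition matchings :: "'a set set \<Rightarrow> nat \<Rightarrow> 'a set set set" where
  "matchings S i = {M. M \<subseteq> S \<and> card M = i \<and>
      (\<forall>e1\<in>M. \<forall>e2\<in>M. e1 \<noteq> e2 \<longrightarrow> e1 \<inter> e2 = {})}"

definition Ksum :: "'a set set \<Rightarrow> 'a set set \<Rightarrow> nat \<Rightarrow> real" where
  "Ksum E S i = (\<Sum>M\<in>matchings S i. \<Prod>e\<in>M. Mw E e)"

definition offcycle_edges :: "'a set set \<Rightarrow> 'a set \<Rightarrow> 'a set set" where
  "offcycle_edges E C = {e\<in>E. e \<inter> C = {}}"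

definition Kc :: "'a set set \<Rightarrow> 'a set \<Rightarrow> nat \<Rightarrow> real" where
  "Kc E C i = Ksum E (offcycle_edges E C) i"

text \<open>K^g_{2i}(2,...,r) for a path p (p = v or p = w): remove edges p(l-1)p(l), 2 \<le> l \<le> r.\<close>
definition Kpath :: "'a set set \<Rightarrow> 'a set \<Rightarrow> (nat \<Rightarrow> 'a) \<Rightarrow> nat \<Rightarrow> nat \<Rightarrow> real" where
  "Kpath E C p r i = Ksum E (offcycle_edges E C - {{p (l - 1), p l} | l. 2 \<le> l \<and> l \<le> r}) i"

definition Lpath :: "'a set set \<Rightarrow> 'a set \<Rightarrow> (nat \<Rightarrow> 'a) \<Rightarrow> (nat \<Rightarrow> 'a) \<Rightarrow> nat \<Rightarrow> nat \<Rightarrow> real" where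
  "Lpath E C v w r i = Kpath E C v r i + Kpath E C w r i"

end

theory Submission
imports
  "Jordan_Normal_Form.Char_Poly"
  "Berlekamp_Zassenhaus.Factor_Bound"
  "HOL-Combinatorics.Cycles"
  Defs
begin

text \<open>
  An eigenvalue $\mu$ of $2T$, where $T$ is the transition matrix of the simple random walk, has the
  form $l + 1/l$ for an eigenvalue $l$ of the Grover walk, so periodicity gives $l^m = 1$. Hence $\mu$
  is a root of the monic integer polynomial $C_m - 2$, where $C_m(l + 1/l) = l^m + l^{-m}$, and by
  Gauss's lemma the characteristic polynomial of $2T$ has integer coefficients.

  A permutation that moves vertices along edges of a unicycle graph is an involution given by a
  matching, or a rotation of the cycle composed with an involution off the cycle. The two kinds
  move an even and an odd number of vertices, so by the Leibniz formula the coefficients are, up to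
  sign, $4^i$ times the weighted matching sums of all edges and of the edges off the cycle. Deleting
  the edges at the vertex of degree 4 and then the path edges one at a time turns these two
  families of integers into the claims.
\<close>

hide_const (open) UnivPoly.coeff UnivPoly.monom UnivPoly.deg Module.smult Coset.order

subsection \<open>Integral characteristic polynomials\<close>

text \<open>The obstacle is a factor 1/2. An edge between two vertices of degree 2 has weight 1/4,
  which one factor 4 cancels exactly, whereas each of the four edges at the hub \<open>c 0\<close>
  of degree 4 has weight 1/8 and leaves a half behind. Halves are removed only in pairs. For claim
  (1) the pair consists of the two orientations of the cycle, each of weight -1/2, whose
  contributions add up. For claim (2) the hub edges form two pairs: the two on the cycle contribute
  equal amounts, so their halves add up to an integer, and what remains is half the sum of the
  contributions of the two pendant edges. The argument does not separate these two, hence the sum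
  \<open>L\<close> and the exponent 2(i-1)-1 in place of 2(i-1). For claim (3) all further deletions
  have weight 1/4 and the half is carried along. The recursions are then solved for their
  lower-order term, which consumes a higher matching order at each step, so integrality has to be
  available at all orders.\<close>

lemma monic_rat_factor_int:
  fixes p q :: "rat poly" and P :: "int poly"
  assumes dvd: "p dvd of_int_poly P" and P: "monic P" and p: "monic p"
  shows "coeff p i \<in> \<int>"
proof -
  obtain q where q: "of_int_poly P = p * q"
    using dvd by (auto elim: dvdE)
  obtain d r where dr: "rat_to_normalized_int_poly p = (d, r)"
    by force
  from rat_to_int_factor_explicit[OF q dr] obtain s where s: "P = r * smult (content P) s"
    by auto
  have pr: "p = smult d (of_int_poly r)" and d: "d > 0"
    using rat_to_normalized_int_poly[OF dr] by auto
  \<comment> \<open>Gauss's lemma enters through the integral cofactor \<open>s\<close>: the integer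
    polynomial \<open>r\<close> divides \<open>P\<close> over the integers, so its leading
    coefficient is a unit. As \<open>d\<close> is positive and \<open>p\<close> monic, this leaves
    only \<open>d = 1\<close>.\<close>
  have "lead_coeff r dvd 1"
    using P s lead_coeff_mult[of r "smult (content P) s"] by (metis dvd_triv_left)
  then have "lead_coeff r = 1 \<or> lead_coeff r = -1"
    by auto
  moreover have "d * of_int (lead_coeff r) = 1"
    using p unfolding pr using d by simp
  ultimately have "d = 1"
    using d by auto
  then show ?thesis
    unfolding pr by simp
qed

text \<open>These are 2 T_n(x/2) for the Chebyshev polynomials T_n of the first kind; the rescaling
  makes them monic for n \<ge> 1 with integer coefficients.\<close>

fun cheb :: "nat \<Rightarrow> int poly" where
  "cheb 0 = [:2:]"
| "cheb (Suc 0) = [:0, 1:]"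
| "cheb (Suc (Suc n)) = pCons 0 (cheb (Suc n)) - cheb n"

text \<open>The bound on \<open>cheb n\<close> is carried along for the two-step recursion: the
  subtracted polynomial then cannot reach the leading term.\<close>

lemma cheb_monic: "degree (cheb (Suc n)) = Suc n \<and> lead_coeff (cheb (Suc n)) = 1 \<and> degree (cheb n) \<le> n"
proof (induction n)
  case (Suc n)
  have nz: "cheb (Suc n) \<noteq> 0" using Suc by auto
  have d: "degree (pCons 0 (cheb (Suc n))) = Suc (Suc n)"
    using Suc nz by simp
  have "degree (cheb n) < degree (pCons 0 (cheb (Suc n)))" using Suc d by simp
  then have deg: "degree (cheb (Suc (Suc n))) = Suc (Suc n)"
    using d degree_add_eq_left[of "- cheb n" "pCons 0 (cheb (Suc n))"] by simp
  have "coeff (cheb n) (Suc (Suc n)) = 0"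
    using Suc by (intro coeff_eq_0) auto
  then have "lead_coeff (cheb (Suc (Suc n))) = 1"
    using Suc unfolding deg by (metis coeff_diff coeff_pCons_Suc cheb.simps(3) diff_zero)
  then show ?case using deg Suc by auto
qed auto

lemma cheb_eval:
  fixes l :: "'a :: field"
  assumes "l \<noteq> 0"
  shows "poly (of_int_poly (cheb n)) (l + 1 / l) = l ^ n + 1 / l ^ n"
proof (induction n rule: cheb.induct)
  case (3 n)
  have "poly (of_int_poly (cheb (Suc (Suc n)))) (l + 1 / l)
      = (l + 1 / l) * (l ^ Suc n + 1 / l ^ Suc n) - (l ^ n + 1 / l ^ n)"
    using 3 by (simp add: hom_distribs)
  also have "\<dots> = l ^ Suc (Suc n) + 1 / l ^ Suc (Suc n)"
    using assms by (simp add: field_simps)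
  finally show ?case .
qed (use assms in \<open>auto simp: hom_distribs\<close>)

text \<open>Over the complex numbers the characteristic polynomial splits, and each linear factor
  divides \<open>P\<close>. Eigenvalues may repeat, so the product of the factors is only known to
  divide \<open>P ^ n\<close>, which is still monic and integral. Divisibility descends from the
  complex numbers to the rationals, where Gauss's lemma applies.\<close>

lemma char_poly_coeff_int:
  fixes A :: "rat mat" and P :: "int poly"
  assumes A: "A \<in> carrier_mat n n" and P: "monic P"
    and root: "\<And>\<mu>. eigenvalue (map_mat of_rat A :: complex mat) \<mu> \<Longrightarrow> poly (of_int_poly P) \<mu> = 0"
  shows "coeff (char_poly A) i \<in> \<int>"
proof -
  let ?B = "map_mat of_rat A :: complex mat"
  have B: "?B \<in> carrier_mat n n" using A by auto
  obtain as where as: "char_poly ?B = (\<Prod>a\<leftarrow>as. [:- a, 1:])" "length as = n"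
    using char_poly_factorized[OF B] by auto
  have "[:- a, 1:] dvd of_int_poly P" if "a \<in> set as" for a
  proof -
    have "poly (char_poly ?B) a = 0"
      unfolding as(1) using that by (auto simp: poly_prod_list prod_list_zero_iff)
    then have "poly (of_int_poly P) a = 0"
      using root eigenvalue_root_char_poly[OF B] by auto
    then show ?thesis by (simp add: poly_eq_0_iff_dvd)
  qed
  then have "(\<Prod>a\<leftarrow>as. [:- a, 1:]) dvd (of_int_poly P :: complex poly) ^ length as"
  proof (induction as)
    case (Cons a as)
    then have "[:- a, 1:] * (\<Prod>a\<leftarrow>as. [:- a, 1:])
        dvd of_int_poly P * (of_int_poly P :: complex poly) ^ length as"
      by (intro mult_dvd_mono) auto
    then show ?case by (simp only: list.map prod_list.Cons length_Cons power_Suc)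
  qed simp
  then have "map_poly of_rat (char_poly A) dvd (of_int_poly (P ^ n) :: complex poly)"
    unfolding as(2) as(1)[symmetric] of_rat_hom.char_poly_hom[OF A] by (simp only: of_int_poly_hom.hom_power)
  also have "(of_int_poly (P ^ n) :: complex poly) = map_poly of_rat (of_int_poly (P ^ n) :: rat poly)"
    by (intro poly_eqI) (simp add: coeff_map_poly)
  finally have "char_poly A dvd of_int_poly (P ^ n)"
    by (simp add: of_rat_hom.dvd_map_poly_hom_imp_dvd)
  then show ?thesis
    using monic_rat_factor_int[OF _ monic_power[OF P]] degree_monic_char_poly[OF A] by blast
qed

subsection \<open>The spectrum of the walk\<close>

lemma adj_sym: "adj E a b \<longleftrightarrow> adj E b a"
  by (auto simp: adj_def insert_commute)

text \<open>In the row of \<open>U\<close> at the arc \<open>(a, b)\<close> only the arcs ending at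
  \<open>a\<close> have nonzero entries: all equal 2/deg a, except that the reversed arc loses
  1.\<close>

lemma grover_apply:
  fixes \<psi> :: "'a \<times> 'a \<Rightarrow> complex"
  assumes fin: "finite (arcs E)" and e: "adj E a b"
  shows "(\<Sum>g\<in>arcs E. of_real (grover E (a, b) g) * \<psi> g)
    = 2 / of_nat (deg E a) * (\<Sum>c | adj E a c. \<psi> (c, a)) - \<psi> (b, a)"
proof -
  let ?N = "{c. adj E a c}"
  have sub: "(\<lambda>c. (c, a)) ` ?N \<subseteq> arcs E"
    by (auto simp: arcs_def adj_sym)
  then have finN: "finite ?N"
    using fin by (meson finite_imageD finite_subset inj_onI prod.inject)
  have "(\<Sum>g\<in>arcs E. of_real (grover E (a, b) g) * \<psi> g)
      = (\<Sum>g\<in>(\<lambda>c. (c, a)) ` ?N. of_real (grover E (a, b) g) * \<psi> g)"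
    by (intro sum.mono_neutral_right fin sub ballI)
       (auto simp: grover_def arcs_def adj_sym)
  also have "\<dots> = (\<Sum>c\<in>?N. of_real (grover E (a, b) (c, a)) * \<psi> (c, a))"
    by (subst sum.reindex) (auto simp: inj_on_def)
  also have "\<dots> = (\<Sum>c\<in>?N. 2 / of_nat (deg E a) * \<psi> (c, a) - (if c = b then \<psi> (c, a) else 0))"
    by (intro sum.cong) (auto simp: grover_def algebra_simps)
  also have "\<dots> = 2 / of_nat (deg E a) * (\<Sum>c\<in>?N. \<psi> (c, a)) - \<psi> (b, a)"
    using e finN by (simp add: sum_subtractf sum_distrib_left)
  finally show ?thesis .
qed

lemma grover_pow_eigen:
  fixes \<psi> :: "'a \<times> 'a \<Rightarrow> complex"
  assumes fin: "finite (arcs E)"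
    and eig: "\<And>e. e \<in> arcs E \<Longrightarrow> (\<Sum>g\<in>arcs E. of_real (grover E e g) * \<psi> g) = z * \<psi> e"
    and e: "e \<in> arcs E"
  shows "(\<Sum>f\<in>arcs E. of_real (grover_pow E m e f) * \<psi> f) = z ^ m * \<psi> e"
  using e
proof (induction m arbitrary: e)
  case 0
  then have "(\<Sum>f\<in>arcs E. of_real (grover_pow E 0 e f) * \<psi> f)
      = (\<Sum>f\<in>arcs E. if e = f then \<psi> f else 0)"
    by (intro sum.cong) auto
  then show ?case using 0 fin by simp
next
  case (Suc m)
  have "(\<Sum>f\<in>arcs E. of_real (grover_pow E (Suc m) e f) * \<psi> f)
      = (\<Sum>f\<in>arcs E. \<Sum>g\<in>arcs E. of_real (grover E e g) * (of_real (grover_pow E m g f) * \<psi> f))"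
    by (simp add: sum_distrib_right mult.assoc)
  also have "\<dots> = (\<Sum>g\<in>arcs E. of_real (grover E e g) * (\<Sum>f\<in>arcs E. of_real (grover_pow E m g f) * \<psi> f))"
    by (subst sum.swap) (simp add: sum_distrib_left)
  also have "\<dots> = z ^ m * (\<Sum>g\<in>arcs E. of_real (grover E e g) * \<psi> g)"
    using Suc.IH by (simp add: sum_distrib_left algebra_simps)
  also have "\<dots> = z ^ Suc m * \<psi> e"
    using eig[OF Suc.prems] by simp
  finally show ?case .
qed

lemma grover_eigen_root_of_unity:
  fixes \<psi> :: "'a \<times> 'a \<Rightarrow> complex"
  assumes fin: "finite (arcs E)" and id: "grover_identity_at E m"
    and eig: "\<And>e. e \<in> arcs E \<Longrightarrow> (\<Sum>g\<in>arcs E. of_real (grover E e g) * \<psi> g) = z * \<psi> e"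
    and e: "e \<in> arcs E" "\<psi> e \<noteq> 0"
  shows "z ^ m = 1"
proof -
  have "z ^ m * \<psi> e = (\<Sum>f\<in>arcs E. of_real (grover_pow E m e f) * \<psi> f)"
    using grover_pow_eigen[OF fin eig e(1)] by simp
  also have "\<dots> = (\<Sum>f\<in>arcs E. if e = f then \<psi> f else 0)"
    using id e(1) by (intro sum.cong) (auto simp: grover_identity_at_def)
  also have "\<dots> = \<psi> e" using fin e by simp
  finally show ?thesis using e by simp
qed

text \<open>For an eigenfunction $f$ of the doubled random walk, the span of $f \circ t$ and $f \circ o$
  is invariant under $U$, which acts on it by $f \circ t \mapsto f \circ o \mapsto
  \mu (f \circ o) - f \circ t$.\<close>

lemma walk_eigenvalue:
  fixes f :: "'a \<Rightarrow> complex"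
  assumes fin: "finite (arcs E)" and id: "grover_identity_at E m"
    and eig: "\<And>a b. adj E a b \<Longrightarrow> 2 / of_nat (deg E a) * (\<Sum>c | adj E a c. f c) = \<mu> * f a"
    and x: "adj E x y" "f x \<noteq> 0"
  obtains l where "l \<noteq> 0" "\<mu> = l + 1 / l" "l ^ m = 1"
proof -
  \<comment> \<open>\<open>s\<close> is a square root of the discriminant, which makes
    \<open>l\<close> a root of X^2 - \<mu> X + 1; the other root is 1/l.\<close>
  define s where "s = csqrt (\<mu>\<^sup>2 - 4)"
  define l where "l = (\<mu> + s) / 2"
  have "l\<^sup>2 - \<mu> * l + 1 = (s\<^sup>2 - (\<mu>\<^sup>2 - 4)) / 4"
    unfolding l_def by (simp add: field_simps power2_eq_square)
  then have sq: "l\<^sup>2 - \<mu> * l + 1 = 0"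
    by (simp add: s_def)
  then have l0: "l \<noteq> 0" by auto
  have "\<mu> * l = l * l + 1 - (l\<^sup>2 - \<mu> * l + 1)"
    by (simp add: power2_eq_square)
  then have "\<mu> * l = l * l + 1"
    unfolding sq by simp
  then have "\<mu> * l / l = (l * l + 1) / l" by (rule arg_cong)
  then have \<mu>: "\<mu> = l + 1 / l"
    using l0 by (simp add: add_divide_distrib)
  have apply_t: "(\<Sum>g\<in>arcs E. of_real (grover E e g) * f (snd g)) = f (fst e)" if "e \<in> arcs E" for e
  proof -
    obtain a b where ab: "e = (a, b)" "adj E a b" using \<open>e \<in> arcs E\<close> by (auto simp: arcs_def)
    have "{c. adj E a c} \<subseteq> snd ` arcs E" by (force simp: arcs_def)
    then have "finite {c. adj E a c}"
      using fin finite_surj by blast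
    then have "deg E a \<noteq> 0" using ab by (auto simp: deg_def)
    then show ?thesis
      using grover_apply[OF fin ab(2), of "\<lambda>g. f (snd g)"] ab(1) by (simp add: deg_def)
  qed
  have apply_o: "(\<Sum>g\<in>arcs E. of_real (grover E e g) * f (fst g)) = \<mu> * f (fst e) - f (snd e)"
    if "e \<in> arcs E" for e
  proof -
    obtain a b where ab: "e = (a, b)" "adj E a b" using \<open>e \<in> arcs E\<close> by (auto simp: arcs_def)
    show ?thesis
      using grover_apply[OF fin ab(2), of "\<lambda>g. f (fst g)"] ab eig[OF ab(2)] by simp
  qed
  have "l ^ m = 1"
  \<comment> \<open>The eigenfunction for 1/l is f o o - l (f o t), which may vanish identically. In
    that case f o t itself is an eigenfunction for l. Either root being an m-th root of unity gives
    the claim.\<close>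
  proof (cases "\<forall>e\<in>arcs E. f (fst e) = l * f (snd e)")
    case True
    show ?thesis
    proof (rule grover_eigen_root_of_unity[OF fin id, where \<psi> = "\<lambda>g. f (snd g)" and e = "(y, x)"])
      show "(\<Sum>g\<in>arcs E. of_real (grover E e g) * f (snd g)) = l * f (snd e)" if "e \<in> arcs E" for e
        using apply_t[OF that] True that by simp
    qed (use x in \<open>auto simp: arcs_def adj_sym\<close>)
  next
    case False
    then obtain e where e: "e \<in> arcs E" "f (fst e) - l * f (snd e) \<noteq> 0" by auto
    have "(1 / l) ^ m = 1"
    proof (rule grover_eigen_root_of_unity[OF fin id, where \<psi> = "\<lambda>g. f (fst g) - l * f (snd g)"])
      show "e \<in> arcs E" "f (fst e) - l * f (snd e) \<noteq> 0" using e by simp_all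
    next
      fix e assume "e \<in> arcs E"
      have "(\<Sum>g\<in>arcs E. of_real (grover E e g) * (f (fst g) - l * f (snd g)))
          = (\<Sum>g\<in>arcs E. of_real (grover E e g) * f (fst g))
            - l * (\<Sum>g\<in>arcs E. of_real (grover E e g) * f (snd g))"
        by (simp add: sum_subtractf sum_distrib_left algebra_simps)
      also have "\<dots> = 1 / l * (f (fst e) - l * f (snd e))"
        unfolding apply_t[OF \<open>e \<in> arcs E\<close>] apply_o[OF \<open>e \<in> arcs E\<close>] \<mu>
        using l0 by (simp add: distrib_right right_diff_distrib)
      finally show "(\<Sum>g\<in>arcs E. of_real (grover E e g) * (f (fst g) - l * f (snd g)))
          = 1 / l * (f (fst e) - l * f (snd e))" .
    qed
    then show ?thesis using l0 by (simp add: power_one_over)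
  qed
  then show ?thesis by (rule that[OF l0 \<mu>])
qed

text \<open>The doubled transition matrix, with numeric indices supplied by an enumeration
  \<open>en\<close> of the vertices. It is rational so that Gauss's lemma can be applied to its
  characteristic polynomial.\<close>

definition walk_mat :: "(nat \<Rightarrow> 'a) \<Rightarrow> nat \<Rightarrow> 'a set set \<Rightarrow> rat mat" where
  "walk_mat en n E = mat n n (\<lambda>(i, j). if adj E (en i) (en j) then 2 / of_nat (deg E (en i)) else 0)"

lemma walk_mat_carrier: "walk_mat en n E \<in> carrier_mat n n"
  by (simp add: walk_mat_def)

lemma adj_in_V:
  assumes "simple_graph V E" "adj E a b"
  shows "a \<in> V" "b \<in> V"
proof -
  obtain x y where "{a, b} = {x, y}" "x \<in> V" "y \<in> V"
    using assms unfolding simple_graph_def adj_def by blast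
  then show "a \<in> V" "b \<in> V" by (auto simp: doubleton_eq_iff)
qed

lemma finite_arcs:
  assumes "simple_graph V E"
  shows "finite (arcs E)"
proof (rule finite_subset)
  show "arcs E \<subseteq> V \<times> V"
    using adj_in_V[OF assms] by (auto simp: arcs_def)
  show "finite (V \<times> V)" using assms by (simp add: simple_graph_def)
qed

lemma walk_mat_char_poly_int:
  fixes V :: "'a set"
  assumes G: "simple_graph V E" and en: "bij_betw en {0..<n} V"
    and nbr: "\<And>x. x \<in> V \<Longrightarrow> \<exists>y. adj E x y"
    and per: "grover_identity_at E m" "m \<ge> 1"
  shows "coeff (char_poly (walk_mat en n E)) i \<in> \<int>"
proof (rule char_poly_coeff_int[OF walk_mat_carrier, where P = "cheb m - [:2:]"])
  obtain m' where m': "m = Suc m'" using per by (cases m) auto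
  have "degree (cheb m - [:2:]) = m \<and> coeff (cheb m) m = 1"
    using cheb_monic[of m'] m' degree_add_eq_left[of "[:-2:]" "cheb m"]
    by (auto simp: diff_conv_add_uminus simp del: add_uminus_conv_diff)
  then show "monic (cheb m - [:2:])"
    using m' by (simp add: coeff_pCons)
next
  fix \<mu> :: complex
  let ?B = "map_mat of_rat (walk_mat en n E) :: complex mat"
  assume "eigenvalue ?B \<mu>"
  then obtain v where v: "v \<in> carrier_vec n" "v \<noteq> 0\<^sub>v n" "?B *\<^sub>v v = \<mu> \<cdot>\<^sub>v v"
    by (auto simp: eigenvalue_def eigenvector_def walk_mat_def)
  define f where "f x = v $ inv_into {0..<n} en x" for x
  have fen: "f (en i) = v $ i" if "i < n" for i
    using that en by (simp add: f_def bij_betw_def)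
  have eig: "2 / of_nat (deg E a) * (\<Sum>c | adj E a c. f c) = \<mu> * f a" if ab: "adj E a b" for a b
  proof -
    obtain j where j: "j < n" "a = en j"
      using adj_in_V[OF G ab] en by (auto simp: bij_betw_def)
    have "\<mu> * f a = (?B *\<^sub>v v) $ j"
      using j v fen by simp
    also have "\<dots> = (\<Sum>k\<in>{0..<n}. (if adj E a (en k) then 2 / of_nat (deg E a) else 0) * v $ k)"
      using j v(1) by (auto simp: scalar_prod_def walk_mat_def of_rat_divide intro!: sum.cong)
    also have "\<dots> = (\<Sum>k\<in>{0..<n}. (if adj E a (en k) then 2 / of_nat (deg E a) else 0) * f (en k))"
      using fen by simp
    also have "\<dots> = (\<Sum>c\<in>V. (if adj E a c then 2 / of_nat (deg E a) else 0) * f c)"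
      by (rule sum.reindex_bij_betw[OF en])
    also have "\<dots> = (\<Sum>c | adj E a c. 2 / of_nat (deg E a) * f c)"
      using G adj_in_V[OF G] by (intro sum.mono_neutral_cong_right) (auto simp: simple_graph_def)
    finally show ?thesis by (simp add: sum_distrib_left)
  qed
  obtain k where k: "k < n" "v $ k \<noteq> 0"
    using v by (metis carrier_vecD eq_vecI index_zero_vec)
  then have "en k \<in> V" using en by (auto simp: bij_betw_def)
  \<comment> \<open>The Grover walk lives on arcs: a vertex where the eigenvector is nonzero has to
    be incident with an arc for the lifted eigenfunction to be nonzero.\<close>
  then obtain y where y: "adj E (en k) y" using nbr by blast
  obtain l where l: "l \<noteq> 0" "\<mu> = l + 1 / l" "l ^ m = 1"
    by (rule walk_eigenvalue[where f = f and \<mu> = \<mu>, OF finite_arcs[OF G] per(1) _ y])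
       (use eig k fen in auto)
  show "poly (of_int_poly (cheb m - [:2:])) \<mu> = 0"
    using cheb_eval[OF l(1), of m] l by (simp add: hom_distribs)
qed

subsection \<open>Leibniz expansion\<close>

definition graph_perms :: "'a set \<Rightarrow> 'a set set \<Rightarrow> ('a \<Rightarrow> 'a) set" where
  "graph_perms V E = {\<sigma>. \<sigma> permutes V \<and> (\<forall>x. \<sigma> x \<noteq> x \<longrightarrow> adj E x (\<sigma> x))}"

definition moved :: "('a \<Rightarrow> 'a) \<Rightarrow> 'a set" where
  "moved \<sigma> = {x. \<sigma> x \<noteq> x}"

text \<open>The Leibniz term of a permutation in the characteristic polynomial of the doubled walk,
  with the powers of X from the fixed points stripped off. When all moves follow edges, the matrix
  entries depend only on the degree of the point moved.\<close>

definition perm_weight :: "'a set set \<Rightarrow> ('a \<Rightarrow> 'a) \<Rightarrow> real" where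
  "perm_weight E \<sigma> = of_int (sign \<sigma>) * (\<Prod>x\<in>moved \<sigma>. - 2 / of_nat (deg E x))"

lemma moved_subset: "\<sigma> permutes V \<Longrightarrow> moved \<sigma> \<subseteq> V"
  by (auto simp: moved_def permutes_def)

lemma prod_const_poly:
  fixes g :: "'b \<Rightarrow> 'a :: comm_ring_1"
  shows "(\<Prod>i\<in>S. [:g i:]) = [:\<Prod>i\<in>S. g i:]"
  by (induction S rule: infinite_finite_induct) simp_all

text \<open>With a zero diagonal a fixed point contributes exactly X and a moved point a constant,
  so each permutation yields a single monomial. The bound on \<open>s\<close> makes the truncated
  exponent \<open>n - s\<close> determine the number of moved points.\<close>

lemma char_poly_coeff_permutations:
  fixes N :: "rat mat"
  assumes N: "N \<in> carrier_mat n n" and diag: "\<And>i. i < n \<Longrightarrow> N $$ (i, i) = 0" and s: "s \<le> n"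
  shows "coeff (char_poly N) (n - s)
    = (\<Sum>p | p permutes {0..<n} \<and> card (moved p) = s. of_int (sign p) * (\<Prod>i\<in>moved p. - N $$ (i, p i)))"
proof -
  let ?P = "{p. p permutes {0..<n}}"
  have "char_poly N = (\<Sum>p\<in>?P. of_int (sign p) * (\<Prod>i = 0..<n. char_poly_matrix N $$ (i, p i)))"
    unfolding char_poly_def by (rule det_def'[where n = n]) (use N in auto)
  also have "\<dots> = (\<Sum>p\<in>?P. monom (of_int (sign p) * (\<Prod>i\<in>moved p. - N $$ (i, p i))) (n - card (moved p)))"
  proof (rule sum.cong[OF refl])
    fix p assume "p \<in> ?P"
    then have p: "p permutes {0..<n}" by simp
    have sub: "moved p \<subseteq> {0..<n}" by (rule moved_subset[OF p])
    have pn: "p i < n" if "i < n" for i using permutes_in_image[OF p, of i] that by simp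
    have "(\<Prod>i = 0..<n. char_poly_matrix N $$ (i, p i))
        = (\<Prod>i = 0..<n. if i \<in> moved p then [:- N $$ (i, p i):] else [:0, 1:])"
      using N diag pn by (intro prod.cong) (auto simp: char_poly_matrix_def moved_def)
    also have "\<dots> = (\<Prod>i\<in>moved p. [:- N $$ (i, p i):]) * (\<Prod>i\<in>{0..<n} - moved p. [:0, 1:])"
      using sub by (subst prod.If_cases) (auto simp: Int_absorb1 Diff_eq)
    also have "(\<Prod>i\<in>{0..<n} - moved p. [:0, 1:]) = monom 1 (n - card (moved p))"
      using sub by (simp add: card_Diff_subset finite_subset[OF sub] monom_altdef)
    also have "(\<Prod>i\<in>moved p. [:- N $$ (i, p i):]) = [:\<Prod>i\<in>moved p. - N $$ (i, p i):]"
      by (rule prod_const_poly)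
    finally have *: "(\<Prod>i = 0..<n. char_poly_matrix N $$ (i, p i))
        = [:\<Prod>i\<in>moved p. - N $$ (i, p i):] * monom 1 (n - card (moved p))" .
    have sm: "of_int z * q = Polynomial.smult (of_int z) q" for z and q :: "rat poly"
      unfolding of_int_poly
      by (simp only: mult_pCons_left mult_zero_left pCons_0_0 add_0_right)
    show "of_int (sign p) * (\<Prod>i = 0..<n. char_poly_matrix N $$ (i, p i))
        = monom (of_int (sign p) * (\<Prod>i\<in>moved p. - N $$ (i, p i))) (n - card (moved p))"
      unfolding * sm by (simp add: smult_monom)
  qed
  finally have "coeff (char_poly N) (n - s) = (\<Sum>p\<in>?P. coeff (monom (of_int (sign p) * (\<Prod>i\<in>moved p. - N $$ (i, p i))) (n - card (moved p))) (n - s))"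
    by (simp only: coeff_sum)
  also have "\<dots> = (\<Sum>p | p permutes {0..<n} \<and> card (moved p) = s. of_int (sign p) * (\<Prod>i\<in>moved p. - N $$ (i, p i)))"
  proof (rule sum.mono_neutral_cong_right)
    show "\<forall>p\<in>?P - {p. p permutes {0..<n} \<and> card (moved p) = s}.
       coeff (monom (of_int (sign p) * (\<Prod>i\<in>moved p. - N $$ (i, p i))) (n - card (moved p))) (n - s) = 0"
    proof
      fix p assume p: "p \<in> ?P - {p. p permutes {0..<n} \<and> card (moved p) = s}"
      then have "card (moved p) \<le> n"
        using card_mono[of "{0..<n}" "moved p"] moved_subset[of p "{0..<n}"] by simp
      then have "n - card (moved p) \<noteq> n - s"
        using p s by auto
      then show "coeff (monom (of_int (sign p) * (\<Prod>i\<in>moved p. - N $$ (i, p i)))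
          (n - card (moved p))) (n - s) = 0"
        by simp
    qed
  qed (auto simp: finite_permutations)
  finally show ?thesis .
qed

text \<open>Here periodicity turns into arithmetic: up to the enumeration of the vertices, the sum
  is a coefficient of the integral characteristic polynomial. A permutation with a move that is not
  an edge has a zero factor and drops out.\<close>

lemma perm_weight_sum_int:
  fixes V :: "'a set"
  assumes G: "simple_graph V E"
    and nbr: "\<And>x. x \<in> V \<Longrightarrow> \<exists>y. adj E x y"
    and per: "grover_periodic E"
  shows "(\<Sum>\<sigma> | \<sigma> \<in> graph_perms V E \<and> card (moved \<sigma>) = s. perm_weight E \<sigma>) \<in> \<int>"
proof (cases "s \<le> card V")
  case True
  have fin: "finite V" using G by (simp add: simple_graph_def)
  define n where "n = card V"
  obtain en where en: "bij_betw en {0..<n} V"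
    using ex_bij_betw_nat_finite[OF fin] n_def by blast
  let ?N = "walk_mat en n E"
  let ?C = "map_permutation {0..<n} en"
  let ?P = "{p. p permutes {0..<n} \<and> card (moved p) = s}"
  let ?Q = "{\<sigma>. \<sigma> permutes V \<and> card (moved \<sigma>) = s}"
  obtain m where m: "grover_identity_at E m" "m \<ge> 1"
    using per by (auto simp: grover_periodic_def)
  \<comment> \<open>The Leibniz term for an arbitrary permutation of \<open>V\<close>: it agrees
    with \<open>perm_weight\<close> on \<open>graph_perms\<close> and vanishes elsewhere.\<close>
  define w :: "('a \<Rightarrow> 'a) \<Rightarrow> rat" where
    "w \<sigma> = of_int (sign \<sigma>) * (\<Prod>x\<in>moved \<sigma>. - (if adj E x (\<sigma> x) then 2 / of_nat (deg E x) else 0))" for \<sigma>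
  have en_inj: "inj_on en {0..<n}" and en_im: "en ` {0..<n} = V" using en by (auto simp: bij_betw_def)
  have Cen: "?C p (en i) = en (p i)" if "i < n" for p i
    using that en_inj by (intro map_permutation_apply) auto
  have moved_C: "moved (?C p) = en ` moved p" if p: "p permutes {0..<n}" for p
  proof -
    have pn: "p i < n" if "i < n" for i using permutes_in_image[OF p, of i] that by simp
    have sub: "moved (?C p) \<subseteq> V" using moved_subset[OF map_permutation_permutes[OF en p]] .
    have iff: "en i \<in> moved (?C p) \<longleftrightarrow> i \<in> moved p" if "i < n" for i
      using inj_on_eq_iff[OF en_inj, of "p i" i] that pn[OF that] by (simp add: moved_def Cen)
    show ?thesis
    proof (intro equalityI subsetI)
      fix x assume x: "x \<in> moved (?C p)"
      then have "x \<in> en ` {0..<n}" using sub en_im by blast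
      then obtain i where "i < n" "x = en i" by (elim imageE) simp
      then show "x \<in> en ` moved p" using iff x by blast
    next
      fix x assume "x \<in> en ` moved p"
      then obtain i where i: "i \<in> moved p" "x = en i" by (elim imageE)
      then have "i < n" using moved_subset[OF p] by (meson atLeastLessThan_iff subsetD)
      then show "x \<in> moved (?C p)" using iff i by simp
    qed
  qed
  have "coeff (char_poly ?N) (n - s) = (\<Sum>p\<in>?P. of_int (sign p) * (\<Prod>i\<in>moved p. - ?N $$ (i, p i)))"
    using True n_def
    by (intro char_poly_coeff_permutations walk_mat_carrier) (auto simp: walk_mat_def adj_def)
  also have "\<dots> = (\<Sum>p\<in>?P. w (?C p))"
  proof (rule sum.cong[OF refl])
    fix p assume "p \<in> ?P"
    then have p: "p permutes {0..<n}" by simp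
    have pn: "p i < n" if "i < n" for i using permutes_in_image[OF p, of i] that by simp
    have mp: "moved p \<subseteq> {0..<n}" by (rule moved_subset[OF p])
    have "sign (?C p) = sign p"
      by (rule sign_map_permutation) (use en_inj p in auto)
    moreover have "(\<Prod>x\<in>moved (?C p). - (if adj E x (?C p x) then 2 / of_nat (deg E x) else 0 :: rat))
        = (\<Prod>i\<in>moved p. - ?N $$ (i, p i))"
      unfolding moved_C[OF p] prod.reindex[OF inj_on_subset[OF en_inj mp]]
    proof (rule prod.cong[OF refl])
      fix i assume "i \<in> moved p"
      then have "i < n" "p i < n" using mp pn by auto
      then show "((\<lambda>x. - (if adj E x (?C p x) then 2 / of_nat (deg E x) else 0 :: rat)) \<circ> en) i
          = - ?N $$ (i, p i)"
        by (simp add: Cen walk_mat_def)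
    qed
    ultimately show "of_int (sign p) * (\<Prod>i\<in>moved p. - ?N $$ (i, p i)) = w (?C p)"
      by (simp add: w_def)
  qed
  also have "\<dots> = (\<Sum>\<sigma>\<in>?Q. w \<sigma>)"
  proof (rule sum.reindex_bij_betw)
    have "card (moved (?C p)) = card (moved p)" if "p permutes {0..<n}" for p
      unfolding moved_C[OF that] using moved_subset[OF that]
      by (intro card_image inj_on_subset[OF en_inj])
    note card_C = this
    let ?D = "map_permutation V (inv_into {0..<n} en)"
    have DC: "?D (?C p) = p" if "p permutes {0..<n}" for p
      by (rule map_permutation_compose_inv[OF en that]) (use en_inj in auto)
    have en': "bij_betw (inv_into {0..<n} en) V {0..<n}" by (rule bij_betw_inv_into[OF en])
    have CD: "?C (?D \<sigma>) = \<sigma>" if "\<sigma> permutes V" for \<sigma>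
      by (rule map_permutation_compose_inv[OF en' that])
         (use en_im in \<open>auto simp: f_inv_into_f\<close>)
    have card_D: "card (moved (?D \<sigma>)) = card (moved \<sigma>)" if "\<sigma> permutes V" for \<sigma>
      using card_C[OF map_permutation_permutes[OF en' that]] CD[OF that] by simp
    have Cp: "?C p permutes V" if "p permutes {0..<n}" for p
      by (rule map_permutation_permutes[OF en that])
    have Dp: "?D \<sigma> permutes {0..<n}" if "\<sigma> permutes V" for \<sigma>
      by (rule map_permutation_permutes[OF en' that])
    show "bij_betw ?C ?P ?Q"
    proof (rule bij_betw_byWitness[where f' = ?D])
      show "\<forall>p\<in>?P. ?D (?C p) = p" "\<forall>\<sigma>\<in>?Q. ?C (?D \<sigma>) = \<sigma>"
        using DC CD by blast+
      show "?C ` ?P \<subseteq> ?Q" using card_C Cp by blast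
      show "?D ` ?Q \<subseteq> ?P" using card_D Dp by blast
    qed
  qed
  finally have co: "coeff (char_poly ?N) (n - s) = (\<Sum>\<sigma>\<in>?Q. w \<sigma>)" .
  have "(\<Sum>\<sigma> | \<sigma> \<in> graph_perms V E \<and> card (moved \<sigma>) = s. perm_weight E \<sigma>) = (\<Sum>\<sigma>\<in>?Q. of_rat (w \<sigma>))"
  proof (rule sum.mono_neutral_cong_left)
    show "finite ?Q" by (rule finite_subset[OF _ finite_permutations[OF fin]]) auto
    show "\<forall>\<sigma>\<in>?Q - {\<sigma>. \<sigma> \<in> graph_perms V E \<and> card (moved \<sigma>) = s}. of_rat (w \<sigma>) = (0 :: real)"
    proof
      fix \<sigma> assume "\<sigma> \<in> ?Q - {\<sigma>. \<sigma> \<in> graph_perms V E \<and> card (moved \<sigma>) = s}"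
      then obtain x where \<sigma>: "\<sigma> permutes V" "\<sigma> x \<noteq> x" "\<not> adj E x (\<sigma> x)"
        by (auto simp: graph_perms_def)
      moreover have "finite (moved \<sigma>)"
        using \<sigma>(1) fin finite_subset moved_subset by blast
      ultimately have "(\<Prod>x\<in>moved \<sigma>. - (if adj E x (\<sigma> x) then 2 / of_nat (deg E x) else 0 :: rat)) = 0"
        by (intro prod_zero) (auto simp: moved_def)
      then show "of_rat (w \<sigma>) = (0 :: real)" by (simp add: w_def)
    qed
    show "perm_weight E \<sigma> = of_rat (w \<sigma>)" if "\<sigma> \<in> {\<sigma>. \<sigma> \<in> graph_perms V E \<and> card (moved \<sigma>) = s}" for \<sigma>
    proof -
      have "(\<Prod>x\<in>moved \<sigma>. - (if adj E x (\<sigma> x) then 2 / of_nat (deg E x) else 0 :: rat))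
          = (\<Prod>x\<in>moved \<sigma>. - 2 / of_nat (deg E x))"
        using that by (intro prod.cong) (auto simp: graph_perms_def moved_def)
      then show ?thesis
        by (simp add: perm_weight_def w_def of_rat_mult of_rat_prod of_rat_divide of_rat_minus)
    qed
    show "{\<sigma>. \<sigma> \<in> graph_perms V E \<and> card (moved \<sigma>) = s} \<subseteq> ?Q"
      unfolding graph_perms_def by blast
  qed
  also have "\<dots> = of_rat (coeff (char_poly ?N) (n - s))"
    unfolding co by (simp add: of_rat_sum)
  finally have eq: "(\<Sum>\<sigma> | \<sigma> \<in> graph_perms V E \<and> card (moved \<sigma>) = s. perm_weight E \<sigma>)
      = of_rat (coeff (char_poly ?N) (n - s))" .
  obtain z where "coeff (char_poly ?N) (n - s) = of_int z"
    using walk_mat_char_poly_int[OF G en nbr m, of "n - s"] by (rule Ints_cases)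
  then show ?thesis unfolding eq by simp
next
  case False
  have "card (moved \<sigma>) \<noteq> s" if "\<sigma> \<in> graph_perms V E" for \<sigma>
  proof -
    have "\<sigma> permutes V" using that by (simp add: graph_perms_def)
    moreover have "finite V" using G by (simp add: simple_graph_def)
    ultimately have "card (moved \<sigma>) \<le> card V"
      by (intro card_mono moved_subset)
    then show ?thesis using False by linarith
  qed
  then have empty: "{\<sigma>. \<sigma> \<in> graph_perms V E \<and> card (moved \<sigma>) = s} = {}"
    by blast
  show ?thesis unfolding empty by simp
qed

subsection \<open>Matching sums\<close>

lemma finite_matchings: "finite S \<Longrightarrow> finite (matchings S i)"
  by (rule finite_subset[of _ "Pow S"]) (auto simp: matchings_def)

lemma Ksum_0:
  assumes "finite S"
  shows "Ksum E S 0 = 1"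
proof -
  have "matchings S 0 = {{}}"
    using assms by (auto simp: matchings_def dest: finite_subset)
  then show ?thesis by (simp add: Ksum_def)
qed

lemma Ksum_empty_Suc: "Ksum E {} (Suc i) = 0"
proof -
  have "matchings {} (Suc i) = ({} :: 'a set set set)" by (auto simp: matchings_def)
  then show ?thesis by (simp add: Ksum_def)
qed

text \<open>A matching through \<open>e\<close> is \<open>e\<close> together with a matching of
  edges disjoint from \<open>e\<close>. Nonemptiness of \<open>e\<close> keeps \<open>e\<close> out
  of the latter edge set, so inserting it raises the cardinality.\<close>

lemma matchings_Suc:
  assumes S: "finite S" and e: "e \<in> S" "e \<noteq> {}"
  shows "matchings S (Suc i)
    = matchings (S - {e}) (Suc i) \<union> insert e ` matchings {d \<in> S. d \<inter> e = {}} i"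
proof (intro equalityI subsetI)
  fix M assume M: "M \<in> matchings S (Suc i)"
  show "M \<in> matchings (S - {e}) (Suc i) \<union> insert e ` matchings {d \<in> S. d \<inter> e = {}} i"
  proof (cases "e \<in> M")
    case True
    have "finite M" using M S finite_subset[of M S] by (simp add: matchings_def)
    then have card: "card (M - {e}) = i" using M True by (simp add: matchings_def)
    have pw: "d1 \<inter> d2 = {}" if "d1 \<in> M" "d2 \<in> M" "d1 \<noteq> d2" for d1 d2
      using M that by (simp add: matchings_def)
    have MS: "M \<subseteq> S" using M by (simp add: matchings_def)
    have "M - {e} \<subseteq> {d \<in> S. d \<inter> e = {}}"
    proof
      fix d assume "d \<in> M - {e}"
      then show "d \<in> {d \<in> S. d \<inter> e = {}}" using MS pw[of d e] True by blast
    qed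
    then have "M - {e} \<in> matchings {d \<in> S. d \<inter> e = {}} i"
      using card pw by (simp add: matchings_def)
    moreover have "M = insert e (M - {e})" using True by (simp add: insert_absorb)
    ultimately show ?thesis by (intro UnI2 image_eqI)
  next
    case False
    then show ?thesis using M by (auto simp: matchings_def)
  qed
next
  fix M assume "M \<in> matchings (S - {e}) (Suc i) \<union> insert e ` matchings {d \<in> S. d \<inter> e = {}} i"
  then consider "M \<in> matchings (S - {e}) (Suc i)"
    | M' where "M = insert e M'" "M' \<in> matchings {d \<in> S. d \<inter> e = {}} i"
    by (elim UnE imageE) auto
  then show "M \<in> matchings S (Suc i)"
  proof cases
    case 1
    then show ?thesis by (auto simp: matchings_def)
  next
    case 2
    have sub: "M' \<subseteq> {d \<in> S. d \<inter> e = {}}" using 2(2) by (simp add: matchings_def)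
    then have fin: "finite M'" and nin: "e \<notin> M'" using S e finite_subset[of M' S] by auto
    have pw: "d1 \<inter> d2 = {}" if "d1 \<in> M'" "d2 \<in> M'" "d1 \<noteq> d2" for d1 d2
      using 2(2) that by (simp add: matchings_def)
    have de: "d \<inter> e = {}" "e \<inter> d = {}" if "d \<in> M'" for d using that sub by auto
    have "M' \<subseteq> S" using sub by blast
    moreover have "card (insert e M') = Suc i"
      using fin nin 2(2) by (simp add: matchings_def)
    moreover have "d1 \<inter> d2 = {}" if "d1 \<in> insert e M'" "d2 \<in> insert e M'" "d1 \<noteq> d2" for d1 d2
      using that pw de by (elim insertE) simp_all
    ultimately show ?thesis
      unfolding matchings_def 2(1) using e(1) by simp
  qed
qed

text \<open>The deletion recurrence for matching sums. The weights refer to degrees in the full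
  graph \<open>E\<close>, not in the edge set \<open>S\<close>, and are therefore unchanged when
  edges are deleted.\<close>

lemma Ksum_delete:
  assumes S: "finite S" and e: "e \<in> S" "e \<noteq> {}"
  shows "Ksum E S (Suc i) = Ksum E (S - {e}) (Suc i) + Mw E e * Ksum E {d \<in> S. d \<inter> e = {}} i"
proof -
  let ?A = "matchings (S - {e}) (Suc i)" and ?B = "matchings {d \<in> S. d \<inter> e = {}} i"
  let ?w = "\<lambda>M. \<Prod>e\<in>M. Mw E e"
  have B: "e \<notin> M \<and> finite M" if "M \<in> ?B" for M
  proof -
    have "M \<subseteq> {d \<in> S. d \<inter> e = {}}" using that by (simp add: matchings_def)
    then show ?thesis using e S finite_subset[of M S] by auto
  qed
  have inj: "inj_on (insert e) ?B"
  proof (rule inj_onI)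
    fix M N assume "M \<in> ?B" "N \<in> ?B" "insert e M = insert e N"
    then show "M = N" using B insert_ident[of e M N] by blast
  qed
  have "Ksum E S (Suc i) = (\<Sum>M\<in>?A \<union> insert e ` ?B. ?w M)"
    by (simp add: Ksum_def matchings_Suc[OF assms])
  also have "\<dots> = (\<Sum>M\<in>?A. ?w M) + (\<Sum>M\<in>insert e ` ?B. ?w M)"
    using S by (intro sum.union_disjoint finite_imageI finite_matchings) (auto simp: matchings_def)
  also have "(\<Sum>M\<in>insert e ` ?B. ?w M) = (\<Sum>M\<in>?B. ?w (insert e M))"
    by (simp add: sum.reindex[OF inj])
  also have "\<dots> = (\<Sum>M\<in>?B. Mw E e * ?w M)"
    using B by (intro sum.cong) auto
  finally show ?thesis by (simp add: Ksum_def sum_distrib_left)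
qed

section \<open>Multiplicativity of weights, and matchings viewed as involutions\<close>

lemma moved_compose:
  assumes "inj \<tau>" "moved \<rho> \<inter> moved \<tau> = {}"
  shows "moved (\<rho> \<circ> \<tau>) = moved \<rho> \<union> moved \<tau>"
proof -
  have "\<rho> (\<tau> x) \<noteq> x \<longleftrightarrow> \<rho> x \<noteq> x \<or> \<tau> x \<noteq> x" for x
  proof (cases "\<tau> x = x")
    case False
    then have "\<tau> (\<tau> x) \<noteq> \<tau> x" using assms(1) by (simp add: inj_eq)
    then have "\<rho> (\<tau> x) = \<tau> x" using assms(2) by (auto simp: moved_def)
    then show ?thesis using False by simp
  qed simp
  then show ?thesis by (auto simp: moved_def)
qed

lemma finite_moved: "permutation \<sigma> \<Longrightarrow> finite (moved \<sigma>)"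
  by (simp add: moved_def permutation)

lemma perm_weight_compose:
  assumes "permutation \<rho>" "permutation \<tau>" "moved \<rho> \<inter> moved \<tau> = {}"
  shows "perm_weight E (\<rho> \<circ> \<tau>) = perm_weight E \<rho> * perm_weight E \<tau>"
proof -
  have "inj \<tau>" using assms(2) by (simp add: permutation bij_is_inj)
  then show ?thesis
    using assms finite_moved[OF assms(1)] finite_moved[OF assms(2)]
    by (simp add: perm_weight_def moved_compose sign_compose prod.union_disjoint)
qed

lemma moved_transpose: "a \<noteq> b \<Longrightarrow> moved (Transposition.transpose a b) = {a, b}"
  by (auto simp: moved_def Transposition.transpose_def)

text \<open>The sign -1 and the two factors -2 make the constant -4; this is the origin of the
  powers of 4 attached to matching sums.\<close>

lemma perm_weight_transpose:
  assumes "a \<noteq> b"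
  shows "perm_weight E (Transposition.transpose a b) = - 4 * Mw E {a, b}"
  using assms by (simp add: perm_weight_def moved_transpose sign_swap_id Mw_def)

text \<open>Matchings of \<open>S\<close> encoded as permutations that swap the ends of the matched
  edges. No vertex set is mentioned, so edges can be deleted from \<open>S\<close> without changing
  the ambient set.\<close>

definition edge_involutions :: "'a set set \<Rightarrow> ('a \<Rightarrow> 'a) set" where
  "edge_involutions S = {\<sigma>. (\<forall>x. \<sigma> (\<sigma> x) = x) \<and> (\<forall>x. \<sigma> x \<noteq> x \<longrightarrow> {x, \<sigma> x} \<in> S)}"

lemma edge_involutions_moved: "\<sigma> \<in> edge_involutions S \<Longrightarrow> moved \<sigma> \<subseteq> \<Union>S"
  by (auto simp: edge_involutions_def moved_def)

lemma edge_involutions_permutes: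
  assumes "\<sigma> \<in> edge_involutions S" "moved \<sigma> \<subseteq> W"
  shows "\<sigma> permutes W"
proof -
  have "\<sigma> (\<sigma> x) = x" for x using assms(1) by (simp add: edge_involutions_def)
  moreover have "\<sigma> x = x" if "x \<notin> W" for x
    using that assms(2) by (auto simp: moved_def)
  ultimately show ?thesis unfolding permutes_def by metis
qed

lemma edge_involutions_permutation:
  assumes "finite (\<Union>S)" "\<sigma> \<in> edge_involutions S"
  shows "permutation \<sigma>"
  using permutes_imp_permutation[OF assms(1)] edge_involutions_permutes edge_involutions_moved assms(2)
  by blast

lemma finite_edge_involutions:
  assumes "finite (\<Union>S)"
  shows "finite (edge_involutions S)"
proof (rule finite_subset[OF _ finite_permutations[OF assms]])
  show "edge_involutions S \<subseteq> {\<sigma>. \<sigma> permutes \<Union>S}"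
    using edge_involutions_permutes edge_involutions_moved by blast
qed

text \<open>The pairs \<open>{x, \<sigma> x}\<close> partition the moved points into sets of size
  2.\<close>

lemma even_card_moved:
  assumes "finite (\<Union>S)" "\<sigma> \<in> edge_involutions S"
  shows "even (card (moved \<sigma>))"
proof -
  let ?P = "(\<lambda>x. {x, \<sigma> x}) ` moved \<sigma>"
  have inv: "\<sigma> (\<sigma> x) = x" for x using assms(2) by (simp add: edge_involutions_def)
  have U: "\<Union>?P = moved \<sigma>"
  proof (intro equalityI subsetI)
    fix y assume "y \<in> \<Union>?P"
    then obtain x where x: "x \<in> moved \<sigma>" "y = x \<or> y = \<sigma> x" by blast
    then show "y \<in> moved \<sigma>" using inv[of x] by (auto simp: moved_def)
  qed blast
  have "2 dvd card (\<Union>?P)"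
  proof (rule dvd_partition)
    show "finite (\<Union>?P)"
      unfolding U using edge_involutions_moved[OF assms(2)] assms(1) by (rule finite_subset)
    show "\<forall>c\<in>?P. 2 dvd card c" by (simp add: moved_def)
    have "{x, \<sigma> x} \<inter> {y, \<sigma> y} = {}" if "{x, \<sigma> x} \<noteq> {y, \<sigma> y}" for x y
    proof (rule ccontr)
      assume "{x, \<sigma> x} \<inter> {y, \<sigma> y} \<noteq> {}"
      then have "x = y \<or> x = \<sigma> y \<or> \<sigma> x = y \<or> \<sigma> x = \<sigma> y" by blast
      then have "y = x \<or> y = \<sigma> x" using inv by metis
      then have "{x, \<sigma> x} = {y, \<sigma> y}" using inv[of x] by (elim disjE) (simp_all add: insert_commute)
      then show False using that by contradiction
    qed
    then show "\<forall>c1\<in>?P. \<forall>c2\<in>?P. c1 \<noteq> c2 \<longrightarrow> c1 \<inter> c2 = {}" by blast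
  qed
  then show ?thesis unfolding U .
qed

lemma edge_involutions_delete:
  assumes ab: "a \<noteq> b" "{a, b} \<in> S"
  shows "edge_involutions S = edge_involutions (S - {{a, b}})
    \<union> (\<lambda>\<tau>. Transposition.transpose a b \<circ> \<tau>) ` edge_involutions {d \<in> S. d \<inter> {a, b} = {}}"
    (is "_ = ?A \<union> ?T ` ?B")
proof (intro equalityI subsetI)
  fix \<sigma> assume \<sigma>: "\<sigma> \<in> edge_involutions S"
  have inv: "\<sigma> (\<sigma> x) = x" and ed: "\<sigma> x \<noteq> x \<Longrightarrow> {x, \<sigma> x} \<in> S" for x
    using \<sigma> by (auto simp: edge_involutions_def)
  show "\<sigma> \<in> ?A \<union> ?T ` ?B"
  proof (cases "\<sigma> a = b")
    case True
    then have ba: "\<sigma> b = a" using inv[of a] by simp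
    \<comment> \<open>A transposition is its own inverse, so composing with it again takes the swap
      of \<open>a\<close> and \<open>b\<close> out of \<sigma>.\<close>
    define \<tau> where "\<tau> = ?T \<sigma>"
    have out: "\<sigma> x \<noteq> a" "\<sigma> x \<noteq> b" if "x \<noteq> a" "x \<noteq> b" for x
      using inv[of x] True ba that by auto
    have \<tau>: "\<tau> x = (if x = a \<or> x = b then x else \<sigma> x)" for x
      using out[of x] True ba by (auto simp: \<tau>_def Transposition.transpose_def)
    have "\<tau> (\<tau> x) = x" for x using out[of x] inv[of x] by (simp add: \<tau>)
    moreover have "{x, \<tau> x} \<in> {d \<in> S. d \<inter> {a, b} = {}}" if "\<tau> x \<noteq> x" for x
    proof -
      have x: "x \<noteq> a" "x \<noteq> b" "\<tau> x = \<sigma> x" "\<sigma> x \<noteq> x"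
        using that unfolding \<tau> by (auto split: if_splits)
      then show ?thesis using ed[of x] out[of x] by auto
    qed
    ultimately have "\<tau> \<in> ?B" by (simp add: edge_involutions_def)
    moreover have "\<sigma> = ?T \<tau>"
      by (simp add: \<tau>_def fun_eq_iff)
    ultimately show ?thesis by blast
  next
    case False
    have "{x, \<sigma> x} \<noteq> {a, b}" for x
      using False inv[of b] inv[of a] by (auto simp: doubleton_eq_iff)
    then have "\<sigma> \<in> ?A" using inv ed by (simp add: edge_involutions_def)
    then show ?thesis by blast
  qed
next
  fix \<sigma> assume "\<sigma> \<in> ?A \<union> ?T ` ?B"
  then consider "\<sigma> \<in> ?A" | \<tau> where "\<sigma> = ?T \<tau>" "\<tau> \<in> ?B" by blast
  then show "\<sigma> \<in> edge_involutions S"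
  proof cases
    case 1
    then show ?thesis by (simp add: edge_involutions_def)
  next
    case 2
    have inv: "\<tau> (\<tau> x) = x" and ed: "\<tau> x \<noteq> x \<Longrightarrow> {x, \<tau> x} \<in> S \<and> {x, \<tau> x} \<inter> {a, b} = {}" for x
      using 2(2) by (auto simp: edge_involutions_def)
    have fix_ab: "\<tau> a = a" "\<tau> b = b" using ed[of a] ed[of b] by auto
    have \<sigma>: "\<sigma> x = (if x = a then b else if x = b then a else \<tau> x)" for x
    proof (cases "x = a \<or> x = b")
      case False
      then have "\<tau> x \<noteq> a \<and> \<tau> x \<noteq> b" using inv[of x] fix_ab by metis
      then show ?thesis using False by (simp add: 2(1) Transposition.transpose_def)
    qed (auto simp: 2(1) fix_ab)
    have "\<sigma> (\<sigma> x) = x" for x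
    proof (cases "x = a \<or> x = b")
      case False
      then have "\<tau> x \<noteq> a \<and> \<tau> x \<noteq> b" using inv[of x] fix_ab by metis
      then show ?thesis using False inv[of x] by (simp add: \<sigma>)
    qed (auto simp: \<sigma>)
    moreover have "{x, \<sigma> x} \<in> S" if "\<sigma> x \<noteq> x" for x
      using that ab ed[of x] by (auto simp: \<sigma> insert_commute split: if_splits)
    ultimately show ?thesis by (simp add: edge_involutions_def)
  qed
qed

lemma edge_involutions_card_0:
  fixes S :: "'a set set"
  assumes "finite (\<Union>S)"
  shows "{\<sigma> \<in> edge_involutions S. card (moved \<sigma>) = 0} = {id}"
proof -
  have "\<sigma> = id" if "\<sigma> \<in> edge_involutions S" "card (moved \<sigma>) = 0" for \<sigma>
  proof -
    have "finite (moved \<sigma>)"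
      using edge_involutions_moved[OF that(1)] assms by (rule finite_subset)
    then have "moved \<sigma> = {}" using that(2) by simp
    then show ?thesis by (auto simp: moved_def fun_eq_iff)
  qed
  moreover have "id \<in> edge_involutions S" "card (moved (id :: 'a \<Rightarrow> 'a)) = 0"
    by (simp_all add: edge_involutions_def moved_def)
  ultimately show ?thesis by blast
qed

text \<open>Both sides satisfy the same deletion recurrence, so an explicit bijection between
  involutions and matchings is avoided. The induction is on the size of \<open>S\<close>, since
  deleting an edge and deleting all edges that meet it both give proper subsets.\<close>

lemma edge_involutions_sum:
  assumes "finite S" and "\<And>e. e \<in> S \<Longrightarrow> \<exists>a b. e = {a, b} \<and> a \<noteq> b"
  shows "(\<Sum>\<sigma> | \<sigma> \<in> edge_involutions S \<and> card (moved \<sigma>) = 2 * i. perm_weight E \<sigma>)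
    = (- 4) ^ i * Ksum E S i"
  using assms
proof (induction "card S" arbitrary: S i rule: less_induct)
  case less
  have "finite e" if "e \<in> S" for e
    using less.prems(2)[OF that] by (elim exE) simp
  then have finU: "finite (\<Union>S)" using finite_Union[OF less.prems(1)] by simp
  have ideq: "perm_weight E id = 1" by (simp add: perm_weight_def moved_def)
  show ?case
  proof (cases i)
    case 0
    then show ?thesis
      using edge_involutions_card_0[OF finU] less.prems(1) by (simp add: ideq Ksum_0)
  next
    case (Suc j)
    show ?thesis
    proof (cases "S = {}")
      case True
      have "\<sigma> = id" if "\<sigma> \<in> edge_involutions S" for \<sigma>
        using that True by (auto simp: edge_involutions_def fun_eq_iff)
      moreover have "card (moved id) \<noteq> 2 * i" using Suc by (simp add: moved_def)
      ultimately have empty: "{\<sigma>. \<sigma> \<in> edge_involutions S \<and> card (moved \<sigma>) = 2 * i} = {}"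
        by blast
      show ?thesis unfolding empty by (simp add: True Suc Ksum_empty_Suc)
    next
      case False
      then obtain a b where e: "{a, b} \<in> S" "a \<noteq> b" using less.prems(2) by blast
      let ?S1 = "S - {{a, b}}" and ?S2 = "{d \<in> S. d \<inter> {a, b} = {}}"
      let ?T = "\<lambda>\<tau>. Transposition.transpose a b \<circ> \<tau>"
      let ?I = "\<lambda>S i. {\<sigma>. \<sigma> \<in> edge_involutions S \<and> card (moved \<sigma>) = 2 * i}"
      have "{a, b} \<notin> ?S1" "{a, b} \<notin> ?S2" by simp_all
      then have "?S1 \<noteq> S" "?S2 \<noteq> S" using e(1) by metis+
      then have sub: "?S1 \<subset> S" "?S2 \<subset> S" by (simp_all add: psubset_eq)
      have card: "card ?S1 < card S" "card ?S2 < card S"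
        by (rule psubset_card_mono[OF less.prems(1) sub(1)])
           (rule psubset_card_mono[OF less.prems(1) sub(2)])
      have IH1: "(\<Sum>\<sigma>\<in>?I ?S1 i. perm_weight E \<sigma>) = (- 4) ^ i * Ksum E ?S1 i"
      proof (rule less.hyps[OF card(1)])
        show "finite ?S1" using less.prems(1) by simp
        show "\<exists>a b. e = {a, b} \<and> a \<noteq> b" if "e \<in> ?S1" for e
          using less.prems(2)[of e] that by simp
      qed
      have IH2: "(\<Sum>\<sigma>\<in>?I ?S2 j. perm_weight E \<sigma>) = (- 4) ^ j * Ksum E ?S2 j"
      proof (rule less.hyps[OF card(2)])
        show "finite ?S2" using less.prems(1) by simp
        show "\<exists>a b. e = {a, b} \<and> a \<noteq> b" if "e \<in> ?S2" for e
          using less.prems(2)[of e] that by simp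
      qed
      have finU1: "finite (\<Union>?S1)" and finU2: "finite (\<Union>?S2)"
        by (rule finite_subset[OF _ finU], blast)+
      have fix_ab: "\<tau> a = a" "\<tau> b = b" if "\<tau> \<in> edge_involutions ?S2" for \<tau>
        using that unfolding edge_involutions_def by blast+
      have T: "card (moved (?T \<tau>)) = Suc (Suc (card (moved \<tau>)))"
        "perm_weight E (?T \<tau>) = - 4 * Mw E {a, b} * perm_weight E \<tau>"
        if \<tau>: "\<tau> \<in> edge_involutions ?S2" for \<tau>
      proof -
        have perm: "permutation \<tau>" by (rule edge_involutions_permutation[OF finU2 \<tau>])
        have dis: "moved (Transposition.transpose a b) \<inter> moved \<tau> = {}"
          unfolding moved_transpose[OF e(2)] using fix_ab[OF \<tau>] by (simp add: moved_def)
        have "moved (?T \<tau>) = {a, b} \<union> moved \<tau>"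
          using moved_compose[OF _ dis] perm e by (simp add: moved_transpose permutation bij_is_inj)
        then show "card (moved (?T \<tau>)) = Suc (Suc (card (moved \<tau>)))"
          using fix_ab[OF \<tau>] e finite_moved[OF perm] by (simp add: moved_def)
        show "perm_weight E (?T \<tau>) = - 4 * Mw E {a, b} * perm_weight E \<tau>"
          using perm_weight_compose[OF permutation_swap_id perm dis]
          by (simp add: perm_weight_transpose[OF e(2)])
      qed
      have card_T: "card (moved (?T \<tau>)) = 2 * i \<longleftrightarrow> card (moved \<tau>) = 2 * j"
        if "\<tau> \<in> edge_involutions ?S2" for \<tau>
        using T(1)[OF that] Suc by simp
      have split: "?I S i = ?I ?S1 i \<union> ?T ` ?I ?S2 j"
        unfolding edge_involutions_delete[OF e(2,1)] using card_T by blast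
      have "\<sigma> a \<noteq> b" if "\<sigma> \<in> edge_involutions ?S1" for \<sigma>
      proof
        assume "\<sigma> a = b"
        then have "\<sigma> a \<noteq> a" using e(2) by simp
        then have "{a, \<sigma> a} \<in> ?S1" using that unfolding edge_involutions_def by blast
        then have "{a, b} \<in> ?S1" using \<open>\<sigma> a = b\<close> by simp
        then show False by simp
      qed
      moreover have "?T \<tau> a = b" if "\<tau> \<in> edge_involutions ?S2" for \<tau>
        using fix_ab(1)[OF that] by simp
      ultimately have disj: "?I ?S1 i \<inter> ?T ` ?I ?S2 j = {}" by blast
      have fin1: "finite (?I ?S1 i)"
        by (rule finite_subset[OF _ finite_edge_involutions[OF finU1]]) blast
      have fin2: "finite (?T ` ?I ?S2 j)"
        by (rule finite_imageI, rule finite_subset[OF _ finite_edge_involutions[OF finU2]]) blast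
      have inj: "inj_on ?T (?I ?S2 j)"
        by (rule inj_on_inverseI[of _ ?T]) (simp add: fun_eq_iff)
      have "(\<Sum>\<sigma>\<in>?I S i. perm_weight E \<sigma>)
          = (\<Sum>\<sigma>\<in>?I ?S1 i. perm_weight E \<sigma>) + (\<Sum>\<sigma>\<in>?T ` ?I ?S2 j. perm_weight E \<sigma>)"
        unfolding split by (rule sum.union_disjoint[OF fin1 fin2 disj])
      also have "(\<Sum>\<sigma>\<in>?T ` ?I ?S2 j. perm_weight E \<sigma>) = (\<Sum>\<tau>\<in>?I ?S2 j. perm_weight E (?T \<tau>))"
        unfolding sum.reindex[OF inj] by (rule sum.cong) simp_all
      also have "(\<Sum>\<tau>\<in>?I ?S2 j. perm_weight E (?T \<tau>))
          = (\<Sum>\<tau>\<in>?I ?S2 j. - 4 * Mw E {a, b} * perm_weight E \<tau>)"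
        using T(2) by (intro sum.cong) simp_all
      also have "\<dots> = - 4 * Mw E {a, b} * ((- 4) ^ j * Ksum E ?S2 j)"
        unfolding sum_distrib_left[symmetric] IH2 ..
      finally show ?thesis
        using Ksum_delete[OF less.prems(1) e(1), of E j] unfolding IH1
        by (simp add: Suc algebra_simps)
    qed
  qed
qed

subsection \<open>Permutations of a unicycle graph\<close>

lemma sign_funpow:
  assumes "permutation p"
  shows "sign (p ^^ n) = sign p ^ n"
proof (induction n)
  case (Suc n)
  show ?case
    unfolding funpow.simps sign_compose[OF assms permutation_funpow[OF assms]] Suc by simp
qed simp

lemma graph_perms_permutation:
  assumes "simple_graph V E" "\<sigma> \<in> graph_perms V E"
  shows "permutation \<sigma>"
  using assms permutes_imp_permutation[of V \<sigma>] by (simp add: graph_perms_def simple_graph_def)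

lemma moved_inv:
  assumes "bij \<sigma>"
  shows "moved (inv_into UNIV \<sigma>) = moved \<sigma>"
proof -
  have "inv_into UNIV \<sigma> x = x \<longleftrightarrow> \<sigma> x = x" for x
    using assms by (metis bij_inv_eq_iff)
  then show ?thesis by (simp add: moved_def)
qed

lemma graph_perms_inv:
  assumes \<sigma>: "\<sigma> \<in> graph_perms V E"
  shows "inv_into UNIV \<sigma> \<in> graph_perms V E"
proof -
  have p: "\<sigma> permutes V" and ed: "\<And>x. \<sigma> x \<noteq> x \<Longrightarrow> adj E x (\<sigma> x)"
    using \<sigma> by (simp_all add: graph_perms_def)
  have "adj E x (inv_into UNIV \<sigma> x)" if "inv_into UNIV \<sigma> x \<noteq> x" for x
  proof -
    have "\<sigma> (inv_into UNIV \<sigma> x) = x" by (rule permutes_inverses(1)[OF p])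
    then show ?thesis using ed[of "inv_into UNIV \<sigma> x"] that adj_sym[of E x] by simp
  qed
  then show ?thesis using permutes_inv[OF p] by (simp add: graph_perms_def)
qed

lemma graph_perms_compose:
  assumes "\<rho> \<in> graph_perms V E" "\<tau> \<in> graph_perms V E" and dis: "moved \<rho> \<inter> moved \<tau> = {}"
  shows "\<rho> \<circ> \<tau> \<in> graph_perms V E"
proof -
  have p: "\<rho> permutes V" "\<tau> permutes V" using assms by (simp_all add: graph_perms_def)
  have "adj E x (\<rho> (\<tau> x))" if "\<rho> (\<tau> x) \<noteq> x" for x
  proof (cases "\<tau> x = x")
    case True
    then show ?thesis using that assms(1) by (simp add: graph_perms_def)
  next
    case False
    then have "\<tau> (\<tau> x) \<noteq> \<tau> x" using permutes_inj[OF p(2)] by (simp add: inj_eq)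
    then have "\<tau> x \<notin> moved \<rho>" using dis by (auto simp: moved_def)
    then show ?thesis using False assms(2) by (simp add: graph_perms_def moved_def)
  qed
  then show ?thesis using permutes_compose[OF p(2,1)] by (simp add: graph_perms_def)
qed

lemma Ints_neg4: "(- 4 :: real) ^ i * r \<in> \<int> \<longleftrightarrow> 4 ^ i * r \<in> \<int>"
  by (cases "even i") (simp_all add: power_minus_odd)

lemma Collect_mem_Un: "{d \<in> A \<union> B. P d} = {d \<in> A. P d} \<union> {d \<in> B. P d}"
  by blast

section \<open>Structure of a unicycle graph: a cycle with rooted trees attached\<close>

locale unicycle =
  fixes V :: "'a set" and E :: "'a set set" and k :: nat and c :: "nat \<Rightarrow> 'a"
  assumes k3: "3 \<le> k" and k_odd: "odd k"
    and G: "simple_graph V E" and conn: "connected_graph V E" and card_VE: "card V = card E"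
    and c_V: "\<And>i. i < k \<Longrightarrow> c i \<in> V" and c_inj: "inj_on c {..<k}"
    and c_E: "\<And>i. i < k \<Longrightarrow> {c i, c (Suc i mod k)} \<in> E"
begin

abbreviation C where "C \<equiv> c ` {..<k}"

abbreviation F where "F \<equiv> offcycle_edges E C"

definition cycle_edges where "cycle_edges = (\<lambda>i. {c i, c (Suc i mod k)}) ` {..<k}"

lemma finite_V: "finite V" using G by (simp add: simple_graph_def)

lemma edgeE:
  assumes "e \<in> E"
  obtains a b where "e = {a, b}" "a \<noteq> b" "a \<in> V" "b \<in> V"
  using assms G unfolding simple_graph_def by blast

lemma Union_E: "\<Union>E \<subseteq> V"
  by (auto elim!: edgeE)

lemma finite_E: "finite E"
  using Union_E finite_V by (meson finite_UnionD finite_subset)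

lemma c_eq: "i < k \<Longrightarrow> j < k \<Longrightarrow> c i = c j \<longleftrightarrow> i = j"
  using c_inj by (simp add: inj_on_eq_iff)

lemma succ_less: "Suc i mod k < k" using k3 by simp

lemma succ_eq: "i < k \<Longrightarrow> Suc i mod k = (if Suc i = k then 0 else Suc i)"
  by simp

text \<open>Two distinct positions can span the same edge only if each follows the other, which
  would force a cycle of length 2.\<close>

lemma inj_cycle_edges: "inj_on (\<lambda>i. {c i, c (Suc i mod k)}) {..<k}"
proof (rule inj_onI)
  fix i j assume ij: "i \<in> {..<k}" "j \<in> {..<k}"
    and "{c i, c (Suc i mod k)} = {c j, c (Suc j mod k)}"
  then have "i = j \<or> i = Suc j mod k \<and> Suc i mod k = j"
    using succ_less by (simp add: doubleton_eq_iff c_eq) blast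
  then show "i = j"
    using ij k3 succ_eq[of i] succ_eq[of j] by (auto split: if_splits)
qed

lemma card_cycle_edges: "card cycle_edges = k"
  unfolding cycle_edges_def using card_image[OF inj_cycle_edges] by simp

lemma cycle_edges_subset: "e \<in> cycle_edges \<Longrightarrow> e \<subseteq> C"
  using succ_less by (auto simp: cycle_edges_def)

text \<open>\<open>d\<close> is the distance to the cycle and \<open>par\<close> the next vertex on
  a shortest path to it; together they root the trees that hang off the cycle.\<close>

lemma parent_function:
  obtains d :: "'a \<Rightarrow> nat" and par :: "'a \<Rightarrow> 'a"
  where "\<And>x. x \<in> C \<Longrightarrow> d x = 0"
    and "\<And>x. x \<in> V - C \<Longrightarrow> adj E x (par x) \<and> d x = Suc (d (par x))"
proof -
  define d where "d x = (LEAST n. \<exists>y\<in>C. ((adj E) ^^ n) x y)" for x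
  have ex: "\<exists>y\<in>C. ((adj E) ^^ d x) x y" if "x \<in> V" for x
  proof -
    have "c 0 \<in> V" "c 0 \<in> C" using c_V k3 by auto
    then have "(adj E)\<^sup>*\<^sup>* x (c 0)" using conn that by (simp add: connected_graph_def)
    then obtain n where "((adj E) ^^ n) x (c 0)" using rtranclp_imp_relpowp by metis
    then have "\<exists>n. \<exists>y\<in>C. ((adj E) ^^ n) x y" using \<open>c 0 \<in> C\<close> by blast
    then show ?thesis unfolding d_def by (rule LeastI_ex)
  qed
  have le: "d x \<le> n" if "y \<in> C" "((adj E) ^^ n) x y" for x y n
    unfolding d_def by (rule Least_le) (use that in blast)
  have d0: "d x = 0" if "x \<in> C" for x
    using le[of x 0 x] that by simp
  have step: "\<exists>z. adj E x z \<and> d x = Suc (d z)" if x: "x \<in> V - C" for x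
  proof -
    obtain y where y: "y \<in> C" "((adj E) ^^ d x) x y" using ex x by blast
    obtain m where m: "d x = Suc m"
      using y x by (cases "d x") auto
    obtain z where z: "adj E x z" "((adj E) ^^ m) z y"
      using y(2) unfolding m by (metis relpowp_Suc_D2)
    have "d z \<le> m" by (rule le[OF y(1) z(2)])
    obtain y' where y': "y' \<in> C" "((adj E) ^^ d z) z y'"
      using ex[of z] adj_in_V[OF G z(1)] by blast
    have "d x \<le> Suc (d z)" using le[OF y'(1) relpowp_Suc_I2[of "adj E", OF z(1) y'(2)]] .
    then show ?thesis using z(1) m \<open>d z \<le> m\<close> by (intro exI[of _ z]) simp
  qed
  have "\<exists>par. \<forall>x\<in>V - C. adj E x (par x) \<and> d x = Suc (d (par x))"
    by (rule bchoice) (use step in blast)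
  then show ?thesis using that d0 by blast
qed

text \<open>A count: the k cycle edges and the parent edges of the |V| - k remaining vertices are
  pairwise distinct, which already makes |V| = |E| edges. Two vertices are never parents of each
  other, as \<open>d\<close> would then exceed itself by 2.\<close>

lemma edge_structure:
  assumes par: "\<And>x. x \<in> V - C \<Longrightarrow> adj E x (par x) \<and> d x = Suc (d (par x) :: nat)"
  shows "E = cycle_edges \<union> (\<lambda>x. {x, par x}) ` (V - C)"
proof -
  let ?p = "\<lambda>x. {x, par x}"
  have inj: "inj_on ?p (V - C)"
  proof (rule inj_onI)
    fix x y assume x: "x \<in> V - C" and y: "y \<in> V - C" and eq: "{x, par x} = {y, par y}"
    have "x = y \<or> x = par y \<and> par x = y" using eq by (simp add: doubleton_eq_iff) blast
    then show "x = y" using par[OF x] par[OF y] by auto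
  qed
  have sub: "cycle_edges \<union> ?p ` (V - C) \<subseteq> E"
    using c_E par by (auto simp: cycle_edges_def adj_def)
  have disj: "cycle_edges \<inter> ?p ` (V - C) = {}"
    using cycle_edges_subset by blast
  have finc: "finite cycle_edges" by (simp add: cycle_edges_def)
  have CV: "C \<subseteq> V" using c_V by auto
  have cardC: "card C = k" using card_image[OF c_inj] by simp
  have "card (cycle_edges \<union> ?p ` (V - C)) = k + card (V - C)"
    using card_Un_disjoint[OF finc _ disj] finite_V card_image[OF inj] card_cycle_edges by simp
  also have "\<dots> = card E"
    using card_Diff_subset[OF _ CV] card_mono[OF finite_V CV] cardC card_VE by simp
  finally show ?thesis using card_subset_eq[OF finite_E sub] by simp
qed

text \<open>An edge that is not a cycle edge is a parent edge and has an endpoint off the cycle, so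
  the cycle has no chord.\<close>

lemma adj_C:
  assumes "adj E (c i) (c j)" "i < k" "j < k"
  shows "j = Suc i mod k \<or> i = Suc j mod k"
proof -
  obtain d par where par: "\<And>x. x \<in> C \<Longrightarrow> d x = 0"
    "\<And>x. x \<in> V - C \<Longrightarrow> adj E x (par x) \<and> d x = Suc (d (par x))"
    by (rule parent_function) blast
  have "{c i, c j} \<in> E" using assms by (simp add: adj_def)
  moreover have "{c i, c j} \<notin> (\<lambda>x. {x, par x}) ` (V - C)"
  proof
    assume "{c i, c j} \<in> (\<lambda>x. {x, par x}) ` (V - C)"
    then obtain x where "x \<in> V - C" "x \<in> {c i, c j}" by blast
    then show False using assms by auto
  qed
  ultimately have "{c i, c j} \<in> cycle_edges" using edge_structure[OF par(2)] by blast
  then obtain l where "l < k" "{c i, c j} = {c l, c (Suc l mod k)}"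
    by (auto simp: cycle_edges_def)
  then show ?thesis
    using assms succ_less by (auto simp: doubleton_eq_iff c_eq)
qed

text \<open>A vertex of the orbit that is farthest from the cycle has only its parent as a neighbour
  at no greater distance, so its image and its preimage coincide.\<close>

lemma off_cycle_involution:
  assumes \<sigma>: "\<sigma> \<in> graph_perms V E" and x: "x \<notin> C"
  shows "\<sigma> (\<sigma> x) = x"
proof (cases "x \<in> V")
  case True
  obtain d par where d0: "\<And>x. x \<in> C \<Longrightarrow> d x = 0"
    and par: "\<And>x. x \<in> V - C \<Longrightarrow> adj E x (par x) \<and> d x = Suc (d (par x))"
    by (rule parent_function) blast
  have p: "\<sigma> permutes V" and ed: "\<And>x. \<sigma> x \<noteq> x \<Longrightarrow> adj E x (\<sigma> x)"
    using \<sigma> by (simp_all add: graph_perms_def)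
  have inj: "inj \<sigma>" by (rule permutes_inj[OF p])
  obtain N where N: "\<sigma> ^^ N = id" "N > 0"
    using permutation_is_nilpotent[OF graph_perms_permutation[OF G \<sigma>]] by blast
  define Orb where "Orb = range (\<lambda>n. (\<sigma> ^^ n) x)"
  have OrbV: "Orb \<subseteq> V"
  proof -
    have "(\<sigma> ^^ n) x \<in> V" for n
      by (induction n) (use True permutes_in_image[OF p] in simp_all)
    then show ?thesis by (auto simp: Orb_def)
  qed
  then have finOrb: "finite Orb" using finite_V finite_subset by blast
  have xOrb: "x \<in> Orb" unfolding Orb_def by (rule range_eqI[of _ _ 0]) simp
  have "Max (d ` Orb) \<in> d ` Orb" using finOrb xOrb by (intro Max_in) auto
  then obtain y where y: "y \<in> Orb" "d y = Max (d ` Orb)" by (metis imageE)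
  have max: "d z \<le> d y" if "z \<in> Orb" for z
    unfolding y(2) using finOrb that by (intro Max_ge) auto
  have "d x > 0" using par[of x] True x by simp
  then have "d y > 0" using max[OF xOrb] by simp
  then have yC: "y \<in> V - C" using d0[of y] y(1) OrbV by auto
  have up: "w = par y" if "adj E y w" "w \<in> Orb" for w
  proof -
    have "{y, w} \<in> E" using that by (simp add: adj_def)
    moreover have "{y, w} \<notin> cycle_edges" using cycle_edges_subset[of "{y, w}"] yC by blast
    ultimately obtain z where z: "z \<in> V - C" "{y, w} = {z, par z}"
      using edge_structure[OF par] by blast
    then have "y = z \<and> w = par z \<or> y = par z \<and> w = z" by (simp add: doubleton_eq_iff)
    then show ?thesis using par[OF z(1)] max[OF that(2)] by auto
  qed
  obtain n where n: "y = (\<sigma> ^^ n) x" using y(1) by (auto simp: Orb_def)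
  have "\<sigma> (\<sigma> y) = y"
  proof (cases "\<sigma> y = y")
    case False
    \<comment> \<open>The preimage of \<open>y\<close>, written as a forward iterate by means of the
      period \<open>N\<close> so that it visibly lies in the orbit.\<close>
    define z where "z = (\<sigma> ^^ (n + (N - 1))) x"
    have "\<sigma> z = (\<sigma> ^^ Suc (n + (N - 1))) x" by (simp add: z_def)
    also have "Suc (n + (N - 1)) = n + N" using N by simp
    also have "(\<sigma> ^^ (n + N)) x = y" by (simp add: funpow_add N n)
    finally have zy: "\<sigma> z = y" .
    have "z \<noteq> y" using zy False by auto
    then have "adj E y z" using ed[of z] zy adj_sym[of E y z] by simp
    moreover have "z \<in> Orb" by (auto simp: Orb_def z_def)
    moreover have "\<sigma> y \<in> Orb" unfolding Orb_def n by (rule range_eqI[of _ _ "Suc n"]) simp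
    ultimately have "\<sigma> y = z" using up ed[OF False] by metis
    then show ?thesis using zy by simp
  qed simp
  \<comment> \<open>The identity holds at \<open>y\<close>, the n-th iterate of \<open>x\<close>;
    cancelling the injective iterate carries it back to \<open>x\<close>.\<close>
  then have "(\<sigma> ^^ n) (\<sigma> (\<sigma> x)) = (\<sigma> ^^ n) x"
    unfolding n by (simp add: funpow_swap1)
  then show ?thesis using inj_fn[OF inj, of n] by (simp add: inj_eq)
next
  case False
  then have "\<sigma> x = x" using \<sigma> permutes_not_in[of \<sigma> V x] by (simp add: graph_perms_def)
  then show ?thesis by simp
qed

section \<open>Rotations of the cycle and the classification of edge permutations\<close>

definition rot :: "'a \<Rightarrow> 'a" where
  "rot x = (if x \<in> C then c (Suc (inv_into {..<k} c x) mod k) else x)"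

lemma rot_c: "i < k \<Longrightarrow> rot (c i) = c (Suc i mod k)"
  using c_inj by (simp add: rot_def)

lemma rot_off: "x \<notin> C \<Longrightarrow> rot x = x"
  by (simp add: rot_def)

lemma moved_rot: "moved rot = C"
proof -
  have "rot (c i) \<noteq> c i" if "i < k" for i
    using that succ_less k3 succ_eq[of i] by (simp add: rot_c c_eq)
  then show ?thesis using rot_off by (auto simp: moved_def)
qed

lemma rot_permutes: "rot permutes C"
proof (rule bij_imp_permutes)
  have im: "rot ` C \<subseteq> C" using rot_c succ_less by auto
  have "inj_on rot C"
  proof (rule inj_onI)
    fix x y assume "x \<in> C" "y \<in> C" "rot x = rot y"
    then obtain i j where ij: "i < k" "j < k" "x = c i" "y = c j" by auto
    then have "Suc i mod k = Suc j mod k"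
      using \<open>rot x = rot y\<close> succ_less by (simp add: rot_c c_eq del: mod_Suc)
    then have "i = j" using succ_eq[of i] succ_eq[of j] ij by (auto split: if_splits)
    then show "x = y" using ij by simp
  qed
  then show "bij_betw rot C C"
    using endo_inj_surj[OF _ im] by (simp add: bij_betw_def)
qed (rule rot_off)

lemma rot_permutation: "permutation rot"
  by (rule permutes_imp_permutation[OF _ rot_permutes]) simp

lemma rot_funpow: "i < k \<Longrightarrow> (rot ^^ n) (c i) = c ((i + n) mod k)"
proof (induction n)
  case (Suc n)
  then show ?case using rot_c[of "(i + n) mod k"] k3 by (simp add: mod_Suc_eq)
qed simp

text \<open>The k-th power of \<open>rot\<close> is the identity and k is odd, so the sign cannot be
  -1; no factorization into transpositions is needed.\<close>

lemma sign_rot: "sign rot = 1"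
proof -
  have "(rot ^^ k) x = x" for x
  proof (cases "x \<in> C")
    case True
    then show ?thesis using rot_funpow[of _ k] by auto
  next
    case False
    then have "(rot ^^ n) x = x" for n by (induction n) (simp_all add: rot_off)
    then show ?thesis .
  qed
  then have "rot ^^ k = id" by (simp add: fun_eq_iff)
  then have "sign rot ^ k = 1" using sign_funpow[OF rot_permutation, of k] by simp
  then show ?thesis by (cases rot rule: sign_cases) (use k_odd in simp_all)
qed

lemma rot_graph_perm: "rot \<in> graph_perms V E"
proof -
  have "rot permutes V" using permutes_subset[OF rot_permutes] c_V by blast
  moreover have "adj E x (rot x)" if "rot x \<noteq> x" for x
  proof -
    have "x \<in> C" using that rot_off by blast
    then obtain i where i: "i < k" "x = c i" by auto
    then show ?thesis using c_E[OF i(1)] that rot_c[OF i(1)] by (auto simp: adj_def)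
  qed
  ultimately show ?thesis by (simp add: graph_perms_def)
qed

text \<open>A step forward that is not undone propagates around the whole cycle: the image of the
  next vertex stays on the cycle, is adjacent to that vertex and cannot be the vertex just left.
  Hence \<sigma> agrees with \<open>rot\<close> on the cycle, and what is left is an involution off
  the cycle.\<close>

lemma rotation_decomposition:
  assumes \<sigma>: "\<sigma> \<in> graph_perms V E" and i: "i < k" "\<sigma> (\<sigma> (c i)) \<noteq> c i" "\<sigma> (c i) = c (Suc i mod k)"
  obtains \<tau> where "\<tau> \<in> edge_involutions F" "\<sigma> = rot \<circ> \<tau>"
proof -
  have p: "\<sigma> permutes V" and ed: "\<And>x. \<sigma> x \<noteq> x \<Longrightarrow> adj E x (\<sigma> x)"
    using \<sigma> by (simp_all add: graph_perms_def)
  have inj: "\<sigma> x = \<sigma> y \<longleftrightarrow> x = y" for x y using permutes_inj[OF p] by (simp add: inj_eq)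
  have offC: "\<sigma> (\<sigma> x) = x" if "x \<notin> C" for x by (rule off_cycle_involution[OF \<sigma> that])
  have step: "\<sigma> (c ((i + n) mod k)) = c (Suc ((i + n) mod k) mod k)
      \<and> \<sigma> (\<sigma> (c ((i + n) mod k))) \<noteq> c ((i + n) mod k)" for n
  proof (induction n)
    case 0
    then show ?case using i by simp
  next
    case (Suc n)
    define j where "j = (i + n) mod k"
    define j' where "j' = Suc j mod k"
    have j: "j < k" "j' < k" using k3 by (simp_all add: j_def j'_def)
    have IH: "\<sigma> (c j) = c j'" "\<sigma> (\<sigma> (c j)) \<noteq> c j" using Suc unfolding j_def j'_def by blast+
    have nz: "\<sigma> (\<sigma> (c j')) \<noteq> c j'" using IH inj by metis
    \<comment> \<open>Failure of 2-periodicity passes along the orbit. Points off the cycle are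
      2-periodic, so the image of \<open>c j'\<close> is forced onto the cycle.\<close>
    have nz2: "\<sigma> (\<sigma> (\<sigma> (c j'))) \<noteq> \<sigma> (c j')" using nz inj by metis
    then have "\<sigma> (c j') \<in> C" using offC by blast
    then obtain l where l: "l < k" "\<sigma> (c j') = c l" by auto
    have "\<sigma> (c j') \<noteq> c j'" using nz by metis
    then have "adj E (c j') (c l)" using ed[of "c j'"] l by simp
    then have "l = Suc j' mod k \<or> j' = Suc l mod k" by (rule adj_C[OF _ j(2) l(1)])
    moreover have "j' \<noteq> Suc l mod k"
    proof
      assume "j' = Suc l mod k"
      then have "l = j" using succ_eq[OF j(1)] succ_eq[OF l(1)] j l(1) unfolding j'_def
        by (auto split: if_splits)
      then show False using l IH by simp
    qed
    ultimately have "\<sigma> (c j') = c (Suc j' mod k)" using l by simp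
    moreover have "(i + Suc n) mod k = j'" by (simp add: j_def j'_def mod_Suc_eq)
    ultimately show ?case using nz by simp
  qed
  have on_C: "\<sigma> (c j) = rot (c j)" if "j < k" for j
  proof -
    have "(i + (j + k - i)) mod k = j" using i(1) that by simp
    then show ?thesis using step[of "j + k - i"] rot_c[OF that] by simp
  qed
  then have \<sigma>C: "\<sigma> x = rot x" if "x \<in> C" for x using that by auto
  \<comment> \<open>\<open>rot\<close> already covers the cycle, so injectivity leaves no room for a
    point coming from outside. This puts both ends of every edge used by \<tau> off the cycle, as
    membership in \<open>F\<close> requires.\<close>
  have \<sigma>off: "\<sigma> x \<notin> C" if "x \<notin> C" for x
  proof
    assume "\<sigma> x \<in> C"
    then have "\<sigma> x \<in> rot ` C" using permutes_image[OF rot_permutes] by simp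
    then obtain y where "y \<in> C" "\<sigma> x = rot y" by blast
    then have "x = y" using \<sigma>C[of y] inj by metis
    then show False using that \<open>y \<in> C\<close> by simp
  qed
  define \<tau> where "\<tau> x = (if x \<in> C then x else \<sigma> x)" for x
  have "\<tau> (\<tau> x) = x" for x using \<sigma>off[of x] offC[of x] by (simp add: \<tau>_def)
  moreover have "{x, \<tau> x} \<in> F" if "\<tau> x \<noteq> x" for x
  proof -
    have x: "x \<notin> C" "\<tau> x = \<sigma> x" using that by (auto simp: \<tau>_def)
    then show ?thesis
      using ed[of x] that \<sigma>off[OF x(1)] by (simp add: offcycle_edges_def adj_def)
  qed
  ultimately have "\<tau> \<in> edge_involutions F" by (simp add: edge_involutions_def)
  moreover have "\<sigma> x = rot (\<tau> x)" for x
    using \<sigma>C[of x] rot_off[OF \<sigma>off, of x] by (simp add: \<tau>_def)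
  then have "\<sigma> = rot \<circ> \<tau>" by (simp add: fun_eq_iff)
  ultimately show ?thesis by (rule that)
qed

lemma Union_F: "\<Union>F \<subseteq> V" "\<Union>F \<inter> C = {}"
  using Union_E by (auto simp: offcycle_edges_def)

lemma F_moved: "\<tau> \<in> edge_involutions F \<Longrightarrow> moved \<tau> \<inter> C = {}"
  using edge_involutions_moved Union_F(2) by blast

lemma involution_graph_perms:
  assumes "\<tau> \<in> edge_involutions S" "S \<subseteq> E"
  shows "\<tau> \<in> graph_perms V E"
proof -
  have "moved \<tau> \<subseteq> V" using edge_involutions_moved[OF assms(1)] assms(2) Union_E by blast
  then have "\<tau> permutes V" by (rule edge_involutions_permutes[OF assms(1)])
  moreover have "adj E x (\<tau> x)" if "\<tau> x \<noteq> x" for x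
  proof -
    have "{x, \<tau> x} \<in> S" using assms(1) that by (simp add: edge_involutions_def)
    then show ?thesis using assms(2) that by (auto simp: adj_def)
  qed
  ultimately show ?thesis by (simp add: graph_perms_def)
qed

lemma F_subset: "F \<subseteq> E" by (auto simp: offcycle_edges_def)

text \<open>A point that is not 2-periodic lies on the cycle together with its image, and the two
  are consecutive. A forward step gives \<open>rot\<close>; a backward step is a forward step of the
  inverse permutation.\<close>

lemma graph_perms_cases:
  assumes \<sigma>: "\<sigma> \<in> graph_perms V E" and "\<sigma> \<notin> edge_involutions E"
  obtains \<tau> where "\<tau> \<in> edge_involutions F" "\<sigma> = rot \<circ> \<tau> \<or> \<sigma> = inv_into UNIV rot \<circ> \<tau>"
proof -
  have p: "\<sigma> permutes V" and ed: "\<And>x. \<sigma> x \<noteq> x \<Longrightarrow> adj E x (\<sigma> x)"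
    using \<sigma> by (simp_all add: graph_perms_def)
  have inj: "\<sigma> x = \<sigma> y \<longleftrightarrow> x = y" for x y using permutes_inj[OF p] by (simp add: inj_eq)
  obtain x where x: "\<sigma> (\<sigma> x) \<noteq> x"
    using assms(2) ed unfolding edge_involutions_def adj_def by blast
  have x2: "\<sigma> (\<sigma> (\<sigma> x)) \<noteq> \<sigma> x" using x inj by metis
  have "x \<in> C" "\<sigma> x \<in> C" using x x2 off_cycle_involution[OF \<sigma>] by blast+
  then obtain i j where ij: "i < k" "j < k" "x = c i" "\<sigma> x = c j" by auto
  have "\<sigma> x \<noteq> x" using x by metis
  then have "adj E (c i) (c j)" using ed[of x] ij by simp
  then have "j = Suc i mod k \<or> i = Suc j mod k" by (rule adj_C[OF _ ij(1,2)])
  then show ?thesis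
  proof
    assume "j = Suc i mod k"
    then show ?thesis
      using rotation_decomposition[OF \<sigma> ij(1)] x ij(3,4) that by metis
  next
    assume i: "i = Suc j mod k"
    have inv: "inv_into UNIV \<sigma> (\<sigma> y) = y" "\<sigma> (inv_into UNIV \<sigma> y) = y" for y using permutes_inverses[OF p] by auto
    have "inv_into UNIV \<sigma> (c j) = c (Suc j mod k)" using inv(1)[of x] ij i by simp
    moreover have "inv_into UNIV \<sigma> (inv_into UNIV \<sigma> (c j)) \<noteq> c j"
    proof
      assume "inv_into UNIV \<sigma> (inv_into UNIV \<sigma> (c j)) = c j"
      then have "\<sigma> (\<sigma> (c j)) = c j" using inv(2) by metis
      then show False using x2 ij by simp
    qed
    ultimately obtain \<tau> where \<tau>: "\<tau> \<in> edge_involutions F" "inv_into UNIV \<sigma> = rot \<circ> \<tau>"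
      using rotation_decomposition[OF graph_perms_inv[OF \<sigma>] ij(2)] by metis
    have \<tau>inv: "\<tau> (\<tau> y) = y" for y using \<tau>(1) by (simp add: edge_involutions_def)
    have \<tau>C: "\<tau> y = y" if "y \<in> C" for y using F_moved[OF \<tau>(1)] that by (auto simp: moved_def)
    have rinv: "inv_into UNIV rot (rot y) = y" for y using permutes_inverses[OF rot_permutes] by auto
    have "\<sigma> y = inv_into UNIV rot (\<tau> y)" for y
    proof -
      have "rot (\<tau> (\<sigma> y)) = y" using inv(1)[of y] \<tau>(2) by (simp add: fun_eq_iff)
      then have eq: "\<tau> (\<sigma> y) = inv_into UNIV rot y" using rinv[of "\<tau> (\<sigma> y)"] by simp
      \<comment> \<open>The rotation and \<tau> have disjoint supports and commute, so inverting the
        composition preserves the order of the factors.\<close>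
      have "inv_into UNIV rot (\<tau> y) = \<tau> (inv_into UNIV rot y)"
      proof (cases "y \<in> C")
        case True
        then have "inv_into UNIV rot y \<in> C" using permutes_in_image[OF permutes_inv[OF rot_permutes]] by simp
        then show ?thesis using True \<tau>C by simp
      next
        case False
        then have "\<tau> y \<notin> C" using \<tau>C[of "\<tau> y"] \<tau>inv[of y] by auto
        then show ?thesis
          using False permutes_not_in[OF permutes_inv[OF rot_permutes]] by simp
      qed
      also have "\<dots> = \<sigma> y" unfolding eq[symmetric] \<tau>inv ..
      finally show ?thesis by simp
    qed
    then have "\<sigma> = inv_into UNIV rot \<circ> \<tau>" by (simp add: fun_eq_iff)
    then show ?thesis using that \<tau>(1) by blast
  qed
qed

lemma card_moved_rot:
  assumes "\<tau> \<in> edge_involutions F" "\<rho> = rot \<or> \<rho> = inv_into UNIV rot"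
  shows "moved \<rho> \<inter> moved \<tau> = {}" "\<rho> \<circ> \<tau> \<in> graph_perms V E"
    "card (moved (\<rho> \<circ> \<tau>)) = k + card (moved \<tau>)"
proof -
  have m: "moved \<rho> = C"
    using assms(2) moved_rot moved_inv[OF permutes_bij[OF rot_permutes]] by auto
  show dis: "moved \<rho> \<inter> moved \<tau> = {}" using F_moved[OF assms(1)] unfolding m by blast
  have \<tau>: "\<tau> \<in> graph_perms V E" by (rule involution_graph_perms[OF assms(1) F_subset])
  have "\<rho> \<in> graph_perms V E"
    using assms(2) rot_graph_perm graph_perms_inv[OF rot_graph_perm] by auto
  then show "\<rho> \<circ> \<tau> \<in> graph_perms V E" by (rule graph_perms_compose[OF _ \<tau> dis])
  have perm: "permutation \<tau>" by (rule graph_perms_permutation[OF G \<tau>])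
  have "moved (\<rho> \<circ> \<tau>) = C \<union> moved \<tau>"
    using moved_compose[OF bij_is_inj[OF permutation_bijective[OF perm]] dis] m by simp
  then show "card (moved (\<rho> \<circ> \<tau>)) = k + card (moved \<tau>)"
    using card_Un_disjoint[OF _ finite_moved[OF perm], of C] dis m card_image[OF c_inj] by simp
qed

lemma finite_Union_E: "finite (\<Union>E)" "finite (\<Union>F)"
  by (rule finite_subset[OF Union_E finite_V], rule finite_subset[OF Union_F(1) finite_V])

lemma edge_pair: "e \<in> E \<Longrightarrow> \<exists>a b. e = {a, b} \<and> a \<noteq> b"
  by (elim edgeE) blast

end

section \<open>Integrality of the matching sums of all edges and of the off-cycle edges\<close>

locale periodic_unicycle = unicycle +
  assumes per: "grover_periodic E"
    and nbr: "\<And>x. x \<in> V \<Longrightarrow> \<exists>y. adj E x y"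
    and deg_0: "deg E (c 0) = 4" and deg_i: "\<And>i. 1 \<le> i \<Longrightarrow> i < k \<Longrightarrow> deg E (c i) = 2"
begin

lemma Ksum_E_int: "4 ^ i * Ksum E E i \<in> \<int>"
proof -
  have "{\<sigma>. \<sigma> \<in> graph_perms V E \<and> card (moved \<sigma>) = 2 * i}
      = {\<sigma>. \<sigma> \<in> edge_involutions E \<and> card (moved \<sigma>) = 2 * i}"
  proof (intro equalityI subsetI)
    fix \<sigma> assume s: "\<sigma> \<in> {\<sigma>. \<sigma> \<in> graph_perms V E \<and> card (moved \<sigma>) = 2 * i}"
    have "\<sigma> \<in> edge_involutions E"
    proof (rule ccontr)
      assume "\<sigma> \<notin> edge_involutions E"
      then obtain \<tau> where \<tau>: "\<tau> \<in> edge_involutions F" "\<sigma> = rot \<circ> \<tau> \<or> \<sigma> = inv_into UNIV rot \<circ> \<tau>"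
        using graph_perms_cases s by (metis (no_types, lifting) mem_Collect_eq)
      then have "card (moved \<sigma>) = k + card (moved \<tau>)" using card_moved_rot(3) by blast
      moreover have "even (card (moved \<tau>))" by (rule even_card_moved[OF finite_Union_E(2) \<tau>(1)])
      ultimately have "odd (card (moved \<sigma>))" using k_odd by simp
      then show False using s by simp
    qed
    then show "\<sigma> \<in> {\<sigma>. \<sigma> \<in> edge_involutions E \<and> card (moved \<sigma>) = 2 * i}" using s by simp
  qed (use involution_graph_perms in blast)
  then show ?thesis
    using perm_weight_sum_int[OF G nbr per, of "2 * i"] edge_involutions_sum[OF finite_E edge_pair, where i = i and E = E]
    by (simp add: Ints_neg4)
qed

text \<open>Each of the k - 1 cycle vertices of degree 2 contributes -1, an even number of times;
  the hub contributes -2/4, and the sign is 1.\<close>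

lemma perm_weight_rot:
  assumes "\<rho> = rot \<or> \<rho> = inv_into UNIV rot"
  shows "perm_weight E \<rho> = - 1 / 2"
proof -
  have m: "moved \<rho> = C"
    using assms moved_rot moved_inv[OF permutes_bij[OF rot_permutes]] by auto
  have s: "sign \<rho> = 1"
    using assms sign_rot sign_inverse[OF rot_permutation] by auto
  have "(\<Prod>x\<in>C. - 2 / real (deg E x)) = (\<Prod>i<k. - 2 / real (deg E (c i)))"
    by (simp add: prod.reindex[OF c_inj])
  also have "\<dots> = (\<Prod>i\<in>insert 0 {1..<k}. - 2 / real (deg E (c i)))"
    by (rule prod.cong) (use k3 in auto)
  also have "\<dots> = - 2 / 4 * (\<Prod>i\<in>{1..<k}. - 2 / real (deg E (c i)))"
    using deg_0 by simp
  also have "(\<Prod>i\<in>{1..<k}. - 2 / real (deg E (c i))) = (\<Prod>i\<in>{1..<k}. - 1)"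
    by (rule prod.cong[OF refl]) (use deg_i in simp)
  also have "\<dots> = 1" using k_odd by simp
  finally show ?thesis by (simp add: perm_weight_def m s)
qed

text \<open>The permutations moving k + 2i points are the two rotations combined with the
  i-matchings off the cycle. The two weights -1/2 add up to -1, so no half survives; this is claim
  (1).\<close>

lemma Ksum_F_int: "4 ^ i * Ksum E F i \<in> \<int>"
proof -
  let ?I = "{\<tau>. \<tau> \<in> edge_involutions F \<and> card (moved \<tau>) = 2 * i}"
  let ?A = "\<lambda>\<rho>. (\<lambda>\<tau>. \<rho> \<circ> \<tau>) ` ?I"
  have split: "{\<sigma>. \<sigma> \<in> graph_perms V E \<and> card (moved \<sigma>) = k + 2 * i} = ?A rot \<union> ?A (inv_into UNIV rot)"
  proof (intro equalityI subsetI)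
    fix \<sigma> assume s: "\<sigma> \<in> {\<sigma>. \<sigma> \<in> graph_perms V E \<and> card (moved \<sigma>) = k + 2 * i}"
    then have "odd (card (moved \<sigma>))" using k_odd by simp
    then have "\<sigma> \<notin> edge_involutions E" using even_card_moved[OF finite_Union_E(1)] by blast
    then obtain \<tau> where \<tau>: "\<tau> \<in> edge_involutions F" "\<sigma> = rot \<circ> \<tau> \<or> \<sigma> = inv_into UNIV rot \<circ> \<tau>"
      using graph_perms_cases s by (metis (no_types, lifting) mem_Collect_eq)
    then have "card (moved \<sigma>) = k + card (moved \<tau>)" using card_moved_rot(3) by blast
    then have "\<tau> \<in> ?I" using s \<tau>(1) by simp
    then show "\<sigma> \<in> ?A rot \<union> ?A (inv_into UNIV rot)" using \<tau>(2) by blast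
  next
    fix \<sigma> assume "\<sigma> \<in> ?A rot \<union> ?A (inv_into UNIV rot)"
    then obtain \<rho> \<tau> where "\<tau> \<in> ?I" "\<sigma> = \<rho> \<circ> \<tau>" "\<rho> = rot \<or> \<rho> = inv_into UNIV rot" by blast
    then show "\<sigma> \<in> {\<sigma>. \<sigma> \<in> graph_perms V E \<and> card (moved \<sigma>) = k + 2 * i}"
      using card_moved_rot(2,3)[of \<tau> \<rho>] by simp
  qed
  \<comment> \<open>The cycle has length at least 3, so the two rotations differ and the families
    built on them are disjoint.\<close>
  have rr: "rot (rot (c 0)) \<noteq> c 0"
    using rot_funpow[of 0 2] k3 c_eq[of 2 0] by (simp add: numeral_2_eq_2)
  have neq: "(rot \<circ> \<tau>) (c 0) \<noteq> (inv_into UNIV rot \<circ> \<tau>') (c 0)" if "\<tau> \<in> ?I" "\<tau>' \<in> ?I" for \<tau> \<tau>'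
  proof
    assume eq: "(rot \<circ> \<tau>) (c 0) = (inv_into UNIV rot \<circ> \<tau>') (c 0)"
    have "c 0 \<in> C" using k3 by auto
    then have "\<tau> (c 0) = c 0" "\<tau>' (c 0) = c 0"
      using that F_moved[of \<tau>] F_moved[of \<tau>'] by (auto simp: moved_def)
    then have "rot (c 0) = inv_into UNIV rot (c 0)" using eq by simp
    then have "rot (rot (c 0)) = c 0" using permutes_inverses(1)[OF rot_permutes] by simp
    then show False using rr by simp
  qed
  have disj: "?A rot \<inter> ?A (inv_into UNIV rot) = {}"
  proof (rule ccontr)
    assume "?A rot \<inter> ?A (inv_into UNIV rot) \<noteq> {}"
    then obtain \<tau> \<tau>' where *: "\<tau> \<in> ?I" "\<tau>' \<in> ?I" and eq: "rot \<circ> \<tau> = inv_into UNIV rot \<circ> \<tau>'"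
      by (elim ex_in_conv[THEN iffD2, elim_format] exE IntE imageE) simp
    show False using neq[OF *] unfolding eq by simp
  qed
  have finI: "finite ?I"
    by (rule finite_subset[OF _ finite_edge_involutions[OF finite_Union_E(2)]]) blast
  have part: "(\<Sum>\<sigma>\<in>?A \<rho>. perm_weight E \<sigma>) = - 1 / 2 * ((- 4) ^ i * Ksum E F i)"
    if \<rho>: "\<rho> = rot \<or> \<rho> = inv_into UNIV rot" for \<rho>
  proof -
    have perm: "permutation \<rho>" using \<rho> rot_permutation permutation_inverse[OF rot_permutation] by (elim disjE) simp_all
    have inj: "inj_on (\<lambda>\<tau>. \<rho> \<circ> \<tau>) ?I"
    proof (intro inj_onI ext)
      fix \<tau> \<tau>' x assume "\<rho> \<circ> \<tau> = \<rho> \<circ> \<tau>'"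
      then have "(\<rho> \<circ> \<tau>) x = (\<rho> \<circ> \<tau>') x" by (rule fun_cong)
      then have "\<rho> (\<tau> x) = \<rho> (\<tau>' x)" by (simp only: o_apply)
      then show "\<tau> x = \<tau>' x" using permutation_bijective[OF perm] by (simp add: bij_is_inj inj_eq)
    qed
    have "(\<Sum>\<sigma>\<in>?A \<rho>. perm_weight E \<sigma>) = (\<Sum>\<tau>\<in>?I. perm_weight E (\<rho> \<circ> \<tau>))"
      unfolding sum.reindex[OF inj] by (rule sum.cong) simp_all
    also have "\<dots> = (\<Sum>\<tau>\<in>?I. - 1 / 2 * perm_weight E \<tau>)"
    proof (rule sum.cong[OF refl])
      fix \<tau> assume "\<tau> \<in> ?I"
      then have \<tau>: "\<tau> \<in> edge_involutions F" by simp
      show "perm_weight E (\<rho> \<circ> \<tau>) = - 1 / 2 * perm_weight E \<tau>"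
        using perm_weight_compose[OF perm edge_involutions_permutation[OF finite_Union_E(2) \<tau>]
          card_moved_rot(1)[OF \<tau> \<rho>]] perm_weight_rot[OF \<rho>] by simp
    qed
    also have "\<dots> = - 1 / 2 * ((- 4) ^ i * Ksum E F i)"
    proof -
      have "finite F" by (rule finite_subset[OF F_subset finite_E])
      moreover have "\<exists>a b. e = {a, b} \<and> a \<noteq> b" if "e \<in> F" for e
        using edge_pair[of e] F_subset that by blast
      ultimately have "(\<Sum>\<tau>\<in>?I. perm_weight E \<tau>) = (- 4) ^ i * Ksum E F i"
        by (rule edge_involutions_sum)
      then show ?thesis by (simp only: sum_distrib_left[symmetric])
    qed
    finally show ?thesis .
  qed
  have "(\<Sum>\<sigma>\<in>?A rot \<union> ?A (inv_into UNIV rot). perm_weight E \<sigma>)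
      = (\<Sum>\<sigma>\<in>?A rot. perm_weight E \<sigma>) + (\<Sum>\<sigma>\<in>?A (inv_into UNIV rot). perm_weight E \<sigma>)"
    by (rule sum.union_disjoint[OF finite_imageI[OF finI] finite_imageI[OF finI] disj])
  also have "\<dots> = - ((- 4) ^ i * Ksum E F i)"
    unfolding part[OF disjI1[OF refl]] part[OF disjI2[OF refl]] by simp
  finally have "(\<Sum>\<sigma> | \<sigma> \<in> graph_perms V E \<and> card (moved \<sigma>) = k + 2 * i. perm_weight E \<sigma>)
      = - ((- 4) ^ i * Ksum E F i)" unfolding split .
  then show ?thesis
    using perm_weight_sum_int[OF G nbr per, of "k + 2 * i"] by (simp add: Ints_neg4)
qed

end

subsection \<open>Deleting edges\<close>

context periodic_unicycle
begin

text \<open>The stretch of the cycle from \<open>c a\<close> to \<open>c b\<close>. Indices are not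
  reduced modulo k: for \<open>1 \<le> a\<close> and \<open>b < k\<close> the stretch stays clear of
  the hub \<open>c 0\<close>.\<close>

definition seg :: "nat \<Rightarrow> nat \<Rightarrow> 'a set set" where
  "seg a b = (\<lambda>j. {c j, c (Suc j)}) ` {a..<b}"

lemma segE:
  assumes "d \<in> seg a b"
  obtains j where "a \<le> j" "j < b" "d = {c j, c (Suc j)}"
  using assms unfolding seg_def by (metis (no_types, lifting) atLeastLessThan_iff imageE)

lemma finite_seg: "finite (seg a b)" by (simp add: seg_def)

lemma seg_mem_C: "e \<in> seg a b \<Longrightarrow> b < k \<Longrightarrow> e \<subseteq> C"
  by (auto simp: seg_def)

lemma Mw_pair: "a \<noteq> b \<Longrightarrow> Mw E {a, b} = 1 / (real (deg E a) * real (deg E b))"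
  by (simp add: Mw_def)

text \<open>Avoiding both ends of the last edge also excludes the edge before it, hence the bound
  \<open>b - 1\<close>. For \<open>a = b\<close> both sides are empty.\<close>

lemma seg_avoid_last:
  assumes "a \<le> b" "Suc b < k"
  shows "{d \<in> seg a (Suc b). d \<inter> {c b, c (Suc b)} = {}} = seg a (b - 1)"
proof (intro equalityI subsetI)
  fix d assume d: "d \<in> {d \<in> seg a (Suc b). d \<inter> {c b, c (Suc b)} = {}}"
  then obtain j where j: "a \<le> j" "j < Suc b" "d = {c j, c (Suc j)}"
    by (elim CollectE conjE segE)
  have "c j \<noteq> c b" "c (Suc j) \<noteq> c b" using d j(3) by auto
  then have "j \<noteq> b" "Suc j \<noteq> b" by auto
  then have "j < b - 1" using j by arith
  then show "d \<in> seg a (b - 1)" unfolding seg_def j(3) using j(1) by simp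
next
  fix d assume "d \<in> seg a (b - 1)"
  then obtain j where j: "a \<le> j" "j < b - 1" "d = {c j, c (Suc j)}"
    by (rule segE)
  have "d \<in> seg a (Suc b)" unfolding seg_def j(3) using j by simp
  moreover have "c j \<noteq> c b" "c j \<noteq> c (Suc b)" "c (Suc j) \<noteq> c b" "c (Suc j) \<noteq> c (Suc b)"
    using j assms c_eq by simp_all
  ultimately show "d \<in> {d \<in> seg a (Suc b). d \<inter> {c b, c (Suc b)} = {}}"
    using j(3) by simp
qed

text \<open>Each deleted path edge has weight 1/4, absorbed in the factor $4^i$.\<close>

lemma seg_recursion:
  assumes S: "S \<subseteq> F" and ab: "1 \<le> a" "a \<le> b" "Suc b < k"
  shows "4 ^ Suc i * Ksum E (seg a (Suc b) \<union> S) (Suc i)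
    = 4 ^ Suc i * Ksum E (seg a b \<union> S) (Suc i) + 4 ^ i * Ksum E (seg a (b - 1) \<union> S) i"
proof -
  let ?e = "{c b, c (Suc b)}"
  have S_off: "d \<inter> C = {}" if "d \<in> S" for d
    using S that by (auto simp: offcycle_edges_def)
  have eC: "?e \<subseteq> C" using ab by auto
  have fin: "finite (seg a (Suc b) \<union> S)"
    using finite_seg finite_subset[OF S] finite_subset[OF F_subset finite_E] by simp
  have mem: "?e \<in> seg a (Suc b) \<union> S" using ab by (auto simp: seg_def)
  have seg_del: "seg a (Suc b) - {?e} = seg a b"
  proof (intro equalityI subsetI)
    fix d assume d: "d \<in> seg a (Suc b) - {?e}"
    then obtain j where j: "a \<le> j" "j < Suc b" "d = {c j, c (Suc j)}"
      by (elim DiffE segE)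
    have "j \<noteq> b" using d j(3) by auto
    then show "d \<in> seg a b" unfolding seg_def j(3) using j by simp
  next
    fix d assume d: "d \<in> seg a b"
    then obtain j where j: "a \<le> j" "j < b" "d = {c j, c (Suc j)}" by (rule segE)
    have "c j \<noteq> c b" "c j \<noteq> c (Suc b)" using j ab c_eq by simp_all
    then have "d \<noteq> ?e" unfolding j(3) by (simp add: doubleton_eq_iff)
    then show "d \<in> seg a (Suc b) - {?e}" unfolding seg_def j(3) using j by simp
  qed
  have "?e \<notin> S" using S_off[of ?e] eC by auto
  then have del: "seg a (Suc b) \<union> S - {?e} = seg a b \<union> S"
    unfolding Un_Diff seg_del by simp
  have "d \<inter> ?e = {}" if "d \<in> S" for d using S_off[OF that] eC by blast
  then have S_avoid: "{d \<in> S. d \<inter> ?e = {}} = S" by blast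
  have avoid: "{d \<in> seg a (Suc b) \<union> S. d \<inter> ?e = {}} = seg a (b - 1) \<union> S"
    unfolding Collect_mem_Un seg_avoid_last[OF ab(2,3)] S_avoid ..
  have "c b \<noteq> c (Suc b)" using ab c_eq by simp
  then have "Mw E ?e = 1 / 4"
    using deg_i[of b] deg_i[of "Suc b"] ab by (simp add: Mw_pair)
  then show ?thesis
    using Ksum_delete[OF fin mem, of E i] unfolding del avoid by (simp add: algebra_simps)
qed

lemma seg_empty: "seg a a = {}" by (simp add: seg_def)

lemma finite_F_sub: "S \<subseteq> F \<Longrightarrow> finite S"
  using finite_subset[OF F_subset finite_E] by (rule finite_subset[rotated])

lemma Ksum_0_seg: "S \<subseteq> F \<Longrightarrow> Ksum E (seg a b \<union> S) 0 = 1"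
  using finite_F_sub finite_seg by (intro Ksum_0) simp

text \<open>The recursion depends only on the length of the stretch, because all cycle vertices but
  the hub have degree 2. This later identifies the contributions of the two cycle edges at the
  hub.\<close>

lemma seg_shift:
  assumes S: "S \<subseteq> F"
  shows "1 \<le> a \<Longrightarrow> a + l < k \<Longrightarrow> Ksum E (seg a (a + l) \<union> S) i = Ksum E (seg 1 (1 + l) \<union> S) i"
proof (induction l arbitrary: i rule: less_induct)
  case (less l)
  show ?case
  proof (cases "l = 0 \<or> i = 0")
    case True
    then show ?thesis using Ksum_0_seg[OF S] by (auto simp: seg_empty)
  next
    case False
    then obtain l' i' where l: "l = Suc l'" and i: "i = Suc i'" by (metis not0_implies_Suc)
    have prev: "a + l' - 1 = a + (l' - 1) \<or> l' = 0" "1 + l' - 1 = 1 + (l' - 1) \<or> l' = 0"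
      by auto
    have A: "Ksum E (seg a (a + l') \<union> S) (Suc i') = Ksum E (seg 1 (1 + l') \<union> S) (Suc i')"
      using less.IH[of l' "Suc i'"] less.prems l by simp
    have B: "Ksum E (seg a (a + l' - 1) \<union> S) i' = Ksum E (seg 1 (1 + l' - 1) \<union> S) i'"
    proof (cases l')
      case 0
      then show ?thesis by (simp add: seg_def)
    next
      case (Suc l'')
      then show ?thesis using less.IH[of l'' i'] less.prems l by simp
    qed
    have "4 ^ Suc i' * Ksum E (seg a (Suc (a + l')) \<union> S) (Suc i')
        = 4 ^ Suc i' * Ksum E (seg 1 (Suc (1 + l')) \<union> S) (Suc i')"
      using seg_recursion[OF S less.prems(1), of "a + l'" i'] seg_recursion[OF S order_refl, of "1 + l'" i']
        less.prems l A B by simp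
    then show ?thesis unfolding l i by simp
  qed
qed

text \<open>The recursion run forwards: attaching a stretch of the cycle to an edge set preserves
  integrality at all orders.\<close>

lemma seg_int:
  assumes S: "S \<subseteq> F" and int: "\<And>i. 4 ^ i * Ksum E S i \<in> \<int>"
  shows "1 + l < k \<Longrightarrow> 4 ^ i * Ksum E (seg 1 (1 + l) \<union> S) i \<in> \<int>"
proof (induction l arbitrary: i rule: less_induct)
  case (less l)
  show ?case
  proof (cases "l = 0 \<or> i = 0")
    case True
    then show ?thesis using Ksum_0_seg[OF S] int[of i] by (auto simp: seg_empty)
  next
    case False
    then obtain l' i' where l: "l = Suc l'" and i: "i = Suc i'" by (metis not0_implies_Suc)
    have A: "4 ^ Suc i' * Ksum E (seg 1 (1 + l') \<union> S) (Suc i') \<in> \<int>"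
      using less.IH[of l' "Suc i'"] less.prems l by simp
    have B: "4 ^ i' * Ksum E (seg 1 (1 + l' - 1) \<union> S) i' \<in> \<int>"
    proof (cases l')
      case 0
      then show ?thesis using int[of i'] by (simp add: seg_def)
    next
      case (Suc l'')
      then show ?thesis using less.IH[of l'' i'] less.prems l by simp
    qed
    have "4 ^ Suc i' * Ksum E (seg 1 (Suc (1 + l')) \<union> S) (Suc i') \<in> \<int>"
      using seg_recursion[OF S order_refl, of "1 + l'" i'] less.prems l Ints_add[OF A B] by simp
    then show ?thesis unfolding l i by simp
  qed
qed

text \<open>The recursion run backwards, from the longest stretch to the empty one. Its second term
  has lower order, so an outer induction on the order supplies it for every length while an inner
  one shortens the stretch. The half stays attached to the sum of the two families.\<close>

lemma seg_unwind:
  assumes S: "S \<subseteq> F" "S' \<subseteq> F"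
    and int: "\<And>i. 4 ^ i * (Ksum E (seg 1 (k - 1) \<union> S) i + Ksum E (seg 1 (k - 1) \<union> S') i) / 2 \<in> \<int>"
  shows "4 ^ i * (Ksum E S i + Ksum E S' i) / 2 \<in> \<int>"
proof -
  define Z where "Z l i = 4 ^ i * (Ksum E (seg 1 (1 + l) \<union> S) i + Ksum E (seg 1 (1 + l) \<union> S') i) / 2" for l i
  have Z_Suc: "Z (Suc l) (Suc i) = Z l (Suc i) + Z (l - 1) i" if "1 + Suc l < k" for l i
  proof -
    \<comment> \<open>At \<open>l = 0\<close> the truncated subtraction is harmless, as both
      stretches are empty.\<close>
    have "seg 1 (1 + l - 1) = seg 1 (1 + (l - 1))" by (cases l) (simp_all add: seg_def)
    then show ?thesis
      using seg_recursion[OF S(1) order_refl, of "1 + l" i] seg_recursion[OF S(2) order_refl, of "1 + l" i] that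
      unfolding Z_def by (simp add: algebra_simps add_divide_distrib)
  qed
  have "Z l i \<in> \<int>" if "1 + l < k" for l
    using that
  proof (induction i arbitrary: l)
    \<comment> \<open>At order 0 each family contributes 1 for the empty matching, and half of the
      sum 2 is an integer.\<close>
    case 0
    then show ?case using Ksum_0_seg[OF S(1)] Ksum_0_seg[OF S(2)] by (simp add: Z_def)
  next
    case (Suc i)
    have "l \<le> k - 2" using Suc.prems by simp
    then show ?case
    proof (induction l rule: inc_induct)
      case base
      have "1 + (k - 2) = k - 1" using k3 by simp
      then show ?case using int[of "Suc i"] by (simp add: Z_def)
    next
      case (step l)
      have "Z l (Suc i) = Z (Suc l) (Suc i) - Z (l - 1) i" using Z_Suc[of l i] step by simp
      moreover have "Z (l - 1) i \<in> \<int>" using Suc.IH[of "l - 1"] step by simp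
      ultimately show ?case using step by simp
    qed
  qed
  from this[of 0] show ?thesis using k3 by (simp add: Z_def seg_empty)
qed

end

section \<open>The two paths leaving the hub and deletion along them\<close>

locale pendant_paths = periodic_unicycle +
  fixes v w :: "nat \<Rightarrow> 'a" and t :: nat
  assumes v0: "v 0 = c 0" and w0: "w 0 = c 0"
    and v1: "adj E (c 0) (v 1)" "v 1 \<notin> C"
    and w1: "adj E (c 0) (w 1)" "w 1 \<notin> C"
    and vw1: "v 1 \<noteq> w 1"
    and v_rec: "\<And>j. 2 \<le> j \<Longrightarrow> j \<le> t \<Longrightarrow> adj E (v (j - 1)) (v j) \<and> v j \<noteq> v (j - 2)"
    and w_rec: "\<And>j. 2 \<le> j \<Longrightarrow> j \<le> t \<Longrightarrow> adj E (w (j - 1)) (w j) \<and> w j \<noteq> w (j - 2)"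
    and deg_v: "\<And>j. 1 \<le> j \<Longrightarrow> j \<le> t \<Longrightarrow> deg E (v j) = 2"
    and deg_w: "\<And>j. 1 \<le> j \<Longrightarrow> j \<le> t \<Longrightarrow> deg E (w j) = 2"
    and t2: "2 \<le> t"
begin

lemma finite_nbrs: "finite {b. adj E a b}"
  using adj_in_V(2)[OF G] by (intro finite_subset[OF _ finite_V]) blast

lemma nbrs_eqI:
  assumes "finite A" "\<And>b. b \<in> A \<Longrightarrow> adj E a b" "deg E a = card A"
  shows "adj E a b \<longleftrightarrow> b \<in> A"
proof -
  have "A = {b. adj E a b}"
    using assms by (intro card_subset_eq[OF finite_nbrs]) (auto simp: deg_def)
  then show ?thesis by blast
qed

lemma adj_succ: "i < k \<Longrightarrow> adj E (c i) (c (Suc i mod k))"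
  using c_E[of i] c_eq[of i "Suc i mod k"] succ_less succ_eq[of i] k3 by (auto simp: adj_def)

lemma cycle_nbrs:
  assumes i: "1 \<le> i" "i < k"
  shows "adj E (c i) b \<longleftrightarrow> b = c (i - 1) \<or> b = c (Suc i mod k)"
proof -
  have "Suc (i - 1) mod k = i" using i by simp
  then have 1: "adj E (c i) (c (i - 1))" using adj_succ[of "i - 1"] i adj_sym[of E "c i"] by simp
  have "c (i - 1) \<noteq> c (Suc i mod k)" using i succ_less succ_eq[of i] k3 by (simp add: c_eq) arith
  then have "adj E (c i) b \<longleftrightarrow> b \<in> {c (i - 1), c (Suc i mod k)}"
    using 1 adj_succ[OF i(2)] deg_i[OF i] by (intro nbrs_eqI) auto
  then show ?thesis by simp
qed

lemma hub_nbrs: "adj E (c 0) b \<longleftrightarrow> b = c 1 \<or> b = c (k - 1) \<or> b = v 1 \<or> b = w 1"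
proof -
  have "Suc (k - 1) mod k = 0" using k3 by simp
  then have 1: "adj E (c 0) (c (k - 1))" using adj_succ[of "k - 1"] k3 adj_sym[of E "c 0"] by simp
  have 2: "adj E (c 0) (c 1)" using adj_succ[of 0] k3 by simp
  have 3: "c 1 \<noteq> c (k - 1)" using k3 by (simp add: c_eq)
  have "c 1 \<in> C" "c (k - 1) \<in> C" using k3 by simp_all
  then have "card {c 1, c (k - 1), v 1, w 1} = 4"
    using 3 v1(2) w1(2) vw1 by (auto simp: card_insert_if)
  then have "adj E (c 0) b \<longleftrightarrow> b \<in> {c 1, c (k - 1), v 1, w 1}"
    using 1 2 v1(1) w1(1) deg_0 by (intro nbrs_eqI) auto
  then show ?thesis by simp
qed

abbreviation hub_edges where "hub_edges \<equiv> {{c 0, v 1}, {c 0, w 1}, {c 0, c 1}, {c 0, c (k - 1)}}"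

text \<open>Degree 4 leaves the hub no edge beyond the four listed, and degree 2 allows no tree at
  the other cycle vertices.\<close>

lemma edges_decomposition: "E = hub_edges \<union> seg 1 (k - 1) \<union> F"
proof (intro equalityI subsetI)
  fix e assume e: "e \<in> E"
  show "e \<in> hub_edges \<union> seg 1 (k - 1) \<union> F"
  proof (cases "e \<inter> C = {}")
    case True
    then show ?thesis using e by (simp add: offcycle_edges_def)
  next
    case False
    obtain a b where ab: "e = {a, b}" "a \<noteq> b" using edge_pair[OF e] by blast
    then obtain i b' where i: "i < k" "e = {c i, b'}" "c i \<noteq> b'"
      using False by (auto simp: insert_commute)
    have adj: "adj E (c i) b'" using e i by (simp add: adj_def)
    show ?thesis
    proof (cases "i = 0")
      case True
      then have "b' = c 1 \<or> b' = c (k - 1) \<or> b' = v 1 \<or> b' = w 1" using adj hub_nbrs by simp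
      then show ?thesis using i(2) True by auto
    next
      case i0: False
      then have "b' = c (i - 1) \<or> b' = c (Suc i mod k)" using adj cycle_nbrs[of i b'] i(1) by simp
      then show ?thesis
      proof
        assume b: "b' = c (i - 1)"
        show ?thesis
        proof (cases "i = 1")
          case True
          then show ?thesis using i(2) b by (auto simp: insert_commute)
        next
          case False
          then have "1 \<le> i - 1" "i - 1 < k - 1" using i0 i(1) by arith+
          then have "{c (i - 1), c (Suc (i - 1))} \<in> seg 1 (k - 1)"
            unfolding seg_def by (intro imageI) simp
          then show ?thesis using i(2) b i0 by (simp add: insert_commute)
        qed
      next
        assume b: "b' = c (Suc i mod k)"
        show ?thesis
        proof (cases "Suc i = k")
          case True
          then show ?thesis using i(2) b by (auto simp: insert_commute)
        next
          case False
          then have "{c i, c (Suc i)} \<in> seg 1 (k - 1)"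
            unfolding seg_def using i0 i(1) by (intro imageI) simp
          moreover have "Suc i mod k = Suc i" using False i(1) by simp
          ultimately show ?thesis using i(2) b by simp
        qed
      qed
    qed
  qed
next
  fix e assume "e \<in> hub_edges \<union> seg 1 (k - 1) \<union> F"
  then consider "e \<in> hub_edges" | "e \<in> seg 1 (k - 1)" | "e \<in> F" by blast
  then show "e \<in> E"
  proof cases
    case 1
    then obtain b where "e = {c 0, b}" "adj E (c 0) b" using hub_nbrs by blast
    then show ?thesis by (simp add: adj_def)
  next
    case 2
    then obtain j where j: "1 \<le> j" "j < k - 1" "e = {c j, c (Suc j)}" by (rule segE)
    have "Suc j mod k = Suc j" using j by simp
    then show ?thesis using c_E[of j] j by simp
  next
    case 3
    then show ?thesis using F_subset by blast
  qed
qed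

text \<open>The common hypotheses on \<open>v\<close> and \<open>w\<close>, collected so that each
  fact about the paths is proved once for both.\<close>

definition pendant :: "(nat \<Rightarrow> 'a) \<Rightarrow> bool" where
  "pendant p \<longleftrightarrow> p 0 = c 0 \<and> adj E (c 0) (p 1) \<and> p 1 \<notin> C
    \<and> (\<forall>j. 2 \<le> j \<and> j \<le> t \<longrightarrow> adj E (p (j - 1)) (p j) \<and> p j \<noteq> p (j - 2))
    \<and> (\<forall>j. 1 \<le> j \<and> j \<le> t \<longrightarrow> deg E (p j) = 2)"

lemma pendant_v: "pendant v" and pendant_w: "pendant w"
  unfolding pendant_def using v0 w0 v1 w1 v_rec w_rec deg_v deg_w by blast+

lemma pendant_adj:
  assumes p: "pendant p" and j: "Suc j \<le> t"
  shows "adj E (p j) (p (Suc j))"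
proof (cases "j = 0")
  case True
  then show ?thesis using p by (simp add: pendant_def)
next
  case False
  then have "2 \<le> Suc j" by simp
  then have "adj E (p (Suc j - 1)) (p (Suc j))" using p j unfolding pendant_def by blast
  then show ?thesis by simp
qed

text \<open>A path vertex on the cycle would have degree 2, so it is not the hub; but then all its
  neighbours lie on the cycle, including the preceding path vertex.\<close>

lemma pendant_off_cycle:
  assumes p: "pendant p"
  shows "1 \<le> j \<Longrightarrow> j \<le> t \<Longrightarrow> p j \<notin> C"
proof (induction j rule: nat_induct_at_least)
  case base
  then show ?case using p by (simp add: pendant_def)
next
  case (Suc j)
  show ?case
  proof
    assume "p (Suc j) \<in> C"
    then obtain i where i: "i < k" "p (Suc j) = c i" by auto
    have "deg E (p (Suc j)) = 2" using p Suc.prems unfolding pendant_def by simp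
    then have "i \<noteq> 0" using i(2) deg_0 by (cases "i = 0") simp_all
    moreover have "adj E (c i) (p j)"
      using pendant_adj[OF p Suc.prems] i(2) adj_sym[of E "c i"] by simp
    ultimately have "p j = c (i - 1) \<or> p j = c (Suc i mod k)" using cycle_nbrs[of i "p j"] i(1) by simp
    moreover have "c (i - 1) \<in> C" "c (Suc i mod k) \<in> C"
      using i(1) succ_less by (intro imageI, simp)+
    ultimately have "p j \<in> C" by metis
    then show False using Suc by simp
  qed
qed

lemma pendant_nbrs:
  assumes p: "pendant p" and j: "1 \<le> j" "Suc j \<le> t"
  shows "adj E (p j) b \<longleftrightarrow> b = p (j - 1) \<or> b = p (Suc j)"
proof -
  have 1: "adj E (p j) (p (Suc j))" by (rule pendant_adj[OF p j(2)])
  have "adj E (p (j - 1)) (p j)" using pendant_adj[OF p, of "j - 1"] j by simp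
  then have 2: "adj E (p j) (p (j - 1))" using adj_sym[of E "p j"] by simp
  have "2 \<le> Suc j" using j(1) by simp
  then have "p (Suc j) \<noteq> p (Suc j - 2)" using p j(2) unfolding pendant_def by blast
  moreover have "Suc j - 2 = j - 1" by simp
  ultimately have 3: "p (j - 1) \<noteq> p (Suc j)" by metis
  have "deg E (p j) = 2" using p j unfolding pendant_def by simp
  then have "adj E (p j) b \<longleftrightarrow> b \<in> {p (j - 1), p (Suc j)}"
    using 1 2 3 by (intro nbrs_eqI) auto
  then show ?thesis by simp
qed

text \<open>If \<open>p (Suc j)\<close> returned to \<open>p i\<close>, then \<open>p j\<close>
  would be a neighbour of \<open>p i\<close>, hence \<open>p (i - 1)\<close> or
  \<open>p (Suc i)\<close>. Distinctness of earlier vertices excludes this, except for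
  \<open>Suc i = j\<close>, where the condition against backtracking does.\<close>

lemma pendant_distinct:
  assumes p: "pendant p"
  shows "i < j \<Longrightarrow> j \<le> t \<Longrightarrow> p i \<noteq> p j"
proof (induction j arbitrary: i)
  case (Suc j)
  show ?case
  proof
    assume eq: "p i = p (Suc j)"
    have "p 0 \<in> C" using p k3 by (simp add: pendant_def)
    moreover have "p (Suc j) \<notin> C" using pendant_off_cycle[OF p, of "Suc j"] Suc.prems by simp
    ultimately have i0: "i \<noteq> 0" using eq by metis
    have adj: "adj E (p i) (p j)"
      using pendant_adj[OF p Suc.prems(2)] adj_sym[of E "p (Suc j)"] eq by simp
    then have ij: "i \<noteq> j" by (auto simp: adj_def)
    have "p j = p (i - 1) \<or> p j = p (Suc i)"
      using pendant_nbrs[OF p, of i "p j"] i0 Suc.prems adj by simp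
    moreover have "p (i - 1) \<noteq> p j" using Suc.IH[of "i - 1"] Suc.prems i0 ij by simp
    moreover have "p (Suc i) \<noteq> p j"
    proof (cases "Suc i = j")
      case True
      then have "2 \<le> Suc j" "Suc j - 2 = i" using i0 by simp_all
      then have "p (Suc j) \<noteq> p i" using p Suc.prems(2) unfolding pendant_def by metis
      then show ?thesis using eq by simp
    next
      case False
      then show ?thesis using Suc.IH[of "Suc i"] Suc.prems ij by simp
    qed
    ultimately show False by metis
  qed
qed simp

lemma pendant_eq:
  assumes "pendant p" "i \<le> t" "j \<le> t"
  shows "p i = p j \<longleftrightarrow> i = j"
  using pendant_distinct[OF assms(1), of i j] pendant_distinct[OF assms(1), of j i] assms(2,3)
  by (cases i j rule: linorder_cases) auto

text \<open>The edge set underlying \<open>Kpath\<close>. The first path edge ends at the hub and is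
  never in \<open>F\<close>, so removal begins at \<open>l = 2\<close> and \<open>r = 1\<close>
  gives all of \<open>F\<close>.\<close>

definition trimmed :: "(nat \<Rightarrow> 'a) \<Rightarrow> nat \<Rightarrow> 'a set set" where
  "trimmed p r = F - {{p (l - 1), p l} | l. 2 \<le> l \<and> l \<le> r}"

lemma trimmed_subset: "trimmed p r \<subseteq> F" by (auto simp: trimmed_def)

lemma trimmed_1: "trimmed p 1 = F" by (auto simp: trimmed_def)

lemma trimmed_altdef: "trimmed p r = F - (\<lambda>l. {p (l - 1), p l}) ` {2..r}"
  unfolding trimmed_def setcompr_eq_image atLeastAtMost_def atLeast_def atMost_def Collect_conj_eq ..

lemma trimmed_Suc:
  assumes "1 \<le> r"
  shows "trimmed p (Suc r) = trimmed p r - {{p r, p (Suc r)}}"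
proof -
  have "{2..Suc r} = insert (Suc r) {2..r}" using assms by (intro atLeastAtMostSuc_conv) simp
  then show ?thesis unfolding trimmed_altdef by (simp only: image_insert diff_Suc_1) (rule Diff_insert)
qed

lemma pendant_edge_F:
  assumes p: "pendant p" and r: "1 \<le> r" "Suc r \<le> t"
  shows "{p r, p (Suc r)} \<in> F"
  using pendant_adj[OF p r(2)] pendant_off_cycle[OF p, of r] pendant_off_cycle[OF p, of "Suc r"] r
  by (simp add: offcycle_edges_def adj_def)

lemma pendant_edge_trimmed:
  assumes p: "pendant p" and r: "1 \<le> r" "Suc r \<le> t"
  shows "{p r, p (Suc r)} \<in> trimmed p r"
proof -
  have ne: "{p r, p (Suc r)} \<noteq> {p (l - 1), p l}" if l: "2 \<le> l" "l \<le> r" for l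
  proof -
    have "p (Suc r) \<noteq> p (l - 1)" "p (Suc r) \<noteq> p l"
      using pendant_eq[OF p, of "Suc r" "l - 1"] pendant_eq[OF p, of "Suc r" l] l r by simp_all
    then show ?thesis by blast
  qed
  show ?thesis
    unfolding trimmed_altdef
  proof (rule DiffI[OF pendant_edge_F[OF assms]], rule notI)
    assume "{p r, p (Suc r)} \<in> (\<lambda>l. {p (l - 1), p l}) ` {2..r}"
    then obtain l where l: "{p r, p (Suc r)} = {p (l - 1), p l}" "l \<in> {2..r}" by (elim imageE)
    then have "2 \<le> l" "l \<le> r" by simp_all
    from ne[OF this] l(1) show False by contradiction
  qed
qed

text \<open>Path vertices of degree 2 lie on two edges only. The condition \<open>2 \<le> j\<close>
  reflects that for \<open>j = 1\<close> the backward edge leads to the hub and is outside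
  \<open>F\<close>.\<close>

lemma F_edge_at_path:
  assumes p: "pendant p" and j: "1 \<le> j" "Suc j \<le> t" and d: "d \<in> F" "p j \<in> d"
  shows "d = {p j, p (Suc j)} \<or> 2 \<le> j \<and> d = {p (j - 1), p j}"
proof -
  obtain b where b: "d = {p j, b}" "p j \<noteq> b"
    using edge_pair[of d] d F_subset by (metis insertE insert_commute singletonD subsetD)
  then have "adj E (p j) b" using d F_subset by (auto simp: adj_def)
  then have "b = p (j - 1) \<or> b = p (Suc j)" using pendant_nbrs[OF p j] by simp
  then show ?thesis
  proof
    assume b1: "b = p (j - 1)"
    have "b \<notin> C" using d(1) b(1) by (simp add: offcycle_edges_def)
    moreover have "p 0 \<in> C" using p k3 by (simp add: pendant_def)
    ultimately have "j \<noteq> 1" using b1 by auto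
    then show ?thesis using j(1) b(1) b1 by (simp add: insert_commute)
  qed (use b in simp)
qed

text \<open>The next path edge meets only its two neighbours on the path. The one before it is
  already trimmed or, for \<open>r = 1\<close>, ends at the hub; avoiding the edge therefore trims
  two steps further. Both its ends have degree 2, hence the weight 1/4.\<close>

lemma trimmed_recursion:
  assumes p: "pendant p" and r: "1 \<le> r" "Suc (Suc r) \<le> t"
  shows "Ksum E (trimmed p r) (Suc i)
    = Ksum E (trimmed p (Suc r)) (Suc i) + 1 / 4 * Ksum E (trimmed p (Suc (Suc r))) i"
proof -
  let ?e = "{p r, p (Suc r)}"
  have fin: "finite (trimmed p r)" by (rule finite_F_sub[OF trimmed_subset])
  have mem: "?e \<in> trimmed p r" using pendant_edge_trimmed[OF p r(1)] r(2) by simp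
  have tr: "trimmed p (Suc (Suc r)) = trimmed p r - {?e} - {{p (Suc r), p (Suc (Suc r))}}"
    using trimmed_Suc[OF r(1), of p] trimmed_Suc[of "Suc r" p] by simp
  have "d = ?e \<or> d = {p (Suc r), p (Suc (Suc r))} \<longleftrightarrow> d \<inter> ?e \<noteq> {}" if d: "d \<in> trimmed p r" for d
  proof
    assume "d \<inter> ?e \<noteq> {}"
    then consider "p r \<in> d" | "p (Suc r) \<in> d" by blast
    then show "d = ?e \<or> d = {p (Suc r), p (Suc (Suc r))}"
    proof cases
      case 1
      have dF: "d \<in> F" using d trimmed_subset by blast
      have "d \<noteq> {p (r - 1), p r}" if "2 \<le> r"
      proof
        assume "d = {p (r - 1), p r}"
        moreover have "r \<in> {2..r}" using that by simp
        ultimately have "d \<in> (\<lambda>l. {p (l - 1), p l}) ` {2..r}" by (rule image_eqI)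
        then show False using d unfolding trimmed_altdef by simp
      qed
      moreover have "d = ?e \<or> 2 \<le> r \<and> d = {p (r - 1), p r}"
        by (rule F_edge_at_path[OF p r(1) _ dF 1]) (use r(2) in simp)
      ultimately show ?thesis by argo
    next
      case 2
      have dF: "d \<in> F" using d trimmed_subset by blast
      have "d = {p (Suc r), p (Suc (Suc r))} \<or> 2 \<le> Suc r \<and> d = {p (Suc r - 1), p (Suc r)}"
        by (rule F_edge_at_path[OF p _ r(2) dF 2]) simp
      then show ?thesis by auto
    qed
  qed auto
  then have avoid: "{d \<in> trimmed p r. d \<inter> ?e = {}} = trimmed p (Suc (Suc r))"
    unfolding tr by blast
  have "p r \<noteq> p (Suc r)" using pendant_eq[OF p, of r "Suc r"] r by simp
  moreover have "deg E (p r) = 2" "deg E (p (Suc r)) = 2"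
    using p r unfolding pendant_def by simp_all
  ultimately have "Mw E ?e = 1 / 4" by (simp add: Mw_pair)
  then show ?thesis
    using Ksum_delete[OF fin mem, of E i] unfolding avoid trimmed_Suc[OF r(1), of p, symmetric] by simp
qed

lemma hub_not_in: "c 0 \<notin> d" if "d \<in> seg 1 (k - 1) \<union> F" for d
proof
  assume d: "c 0 \<in> d"
  have "d \<notin> F" using d k3 by (auto simp: offcycle_edges_def)
  then have "d \<in> seg 1 (k - 1)" using that by blast
  then obtain j where j: "1 \<le> j" "j < k - 1" "d = {c j, c (Suc j)}" by (rule segE)
  then show False using d c_eq[of 0 j] c_eq[of 0 "Suc j"] by simp
qed

text \<open>\<open>X\<close> holds the hub edges not yet deleted. All of them meet the deleted edge
  in \<open>c 0\<close>, so a matching through that edge continues only away from the hub and from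
  \<open>b\<close>. The weight is 1/(4 * 2).\<close>

lemma delete_hub_edge:
  assumes X: "\<And>d. d \<in> X \<Longrightarrow> c 0 \<in> d" "finite X" and b: "{c 0, b} \<notin> X" "b \<noteq> c 0" "deg E b = 2"
  shows "Ksum E (insert {c 0, b} X \<union> (seg 1 (k - 1) \<union> F)) (Suc i)
    = Ksum E (X \<union> (seg 1 (k - 1) \<union> F)) (Suc i)
      + 1 / 8 * Ksum E {d \<in> seg 1 (k - 1) \<union> F. b \<notin> d} i"
proof -
  let ?Q = "seg 1 (k - 1) \<union> F" and ?e = "{c 0, b}"
  have fin: "finite (insert ?e X \<union> ?Q)" using X(2) finite_seg finite_F_sub[OF subset_refl] by simp
  have "?e \<notin> ?Q" using hub_not_in[of ?e] by blast
  then have del: "insert ?e X \<union> ?Q - {?e} = X \<union> ?Q" using b(1) by blast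
  have "d \<inter> ?e \<noteq> {}" if "d \<in> insert ?e X" for d using X(1)[of d] that by blast
  moreover have "d \<inter> ?e = {} \<longleftrightarrow> b \<notin> d" if "d \<in> ?Q" for d using hub_not_in[OF that] by blast
  ultimately have avoid: "{d \<in> insert ?e X \<union> ?Q. d \<inter> ?e = {}} = {d \<in> ?Q. b \<notin> d}"
    by blast
  have "Mw E ?e = 1 / 8" using b(2,3) deg_0 by (simp add: Mw_pair)
  then show ?thesis using Ksum_delete[OF fin, of ?e E i] unfolding del avoid by simp
qed

lemma avoid_path:
  assumes p: "pendant p"
  shows "{d \<in> seg 1 (k - 1) \<union> F. p 1 \<notin> d} = seg 1 (k - 1) \<union> trimmed p 2"
proof -
  have t2': "Suc 1 \<le> t" using t2 by simp
  have "p 1 \<notin> C" using p by (simp add: pendant_def)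
  moreover have "k - 1 < k" using k3 by simp
  ultimately have "p 1 \<notin> d" if "d \<in> seg 1 (k - 1)" for d
    using seg_mem_C[OF that] by blast
  moreover have "p 1 \<in> d \<longleftrightarrow> d = {p 1, p (Suc 1)}" if "d \<in> F" for d
    using F_edge_at_path[OF p order_refl t2' that] by auto
  moreover have "trimmed p 2 = F - {{p 1, p (Suc 1)}}"
    using trimmed_Suc[OF order_refl, of p] trimmed_1[of p] by (simp add: numeral_2_eq_2)
  ultimately show ?thesis by blast
qed

lemma avoid_cycle_ends:
  "{d \<in> seg 1 (k - 1) \<union> F. c 1 \<notin> d} = seg 2 (k - 1) \<union> F"
  "{d \<in> seg 1 (k - 1) \<union> F. c (k - 1) \<notin> d} = seg 1 (k - 2) \<union> F"
proof -
  have ends: "c 1 \<notin> d" "c (k - 1) \<notin> d" if "d \<in> F" for d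
    using that k3 by (auto simp: offcycle_edges_def)
  have A: "c 1 \<notin> {c j, c (Suc j)} \<longleftrightarrow> 2 \<le> j" if "1 \<le> j" "j < k - 1" for j
    using that c_eq[of 1 j] c_eq[of 1 "Suc j"] k3 by auto
  have B: "c (k - 1) \<notin> {c j, c (Suc j)} \<longleftrightarrow> j < k - 2" if "1 \<le> j" "j < k - 1" for j
    using that c_eq[of "k - 1" j] c_eq[of "k - 1" "Suc j"] k3 by auto
  have "{d \<in> seg 1 (k - 1). c 1 \<notin> d} = seg 2 (k - 1)"
  proof (intro equalityI subsetI)
    fix d assume "d \<in> {d \<in> seg 1 (k - 1). c 1 \<notin> d}"
    then obtain j where j: "1 \<le> j" "j < k - 1" "d = {c j, c (Suc j)}" "c 1 \<notin> d"
      by (elim CollectE conjE segE) simp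
    then show "d \<in> seg 2 (k - 1)" using A[OF j(1,2)] by (simp add: seg_def)
  next
    fix d assume "d \<in> seg 2 (k - 1)"
    then obtain j where j: "2 \<le> j" "j < k - 1" "d = {c j, c (Suc j)}" by (rule segE)
    then show "d \<in> {d \<in> seg 1 (k - 1). c 1 \<notin> d}" using A[of j] by (simp add: seg_def)
  qed
  then show "{d \<in> seg 1 (k - 1) \<union> F. c 1 \<notin> d} = seg 2 (k - 1) \<union> F" using ends(1) by blast
  have "{d \<in> seg 1 (k - 1). c (k - 1) \<notin> d} = seg 1 (k - 2)"
  proof (intro equalityI subsetI)
    fix d assume "d \<in> {d \<in> seg 1 (k - 1). c (k - 1) \<notin> d}"
    then obtain j where j: "1 \<le> j" "j < k - 1" "d = {c j, c (Suc j)}" "c (k - 1) \<notin> d"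
      by (elim CollectE conjE segE) simp
    then show "d \<in> seg 1 (k - 2)" using B[OF j(1,2)] by (simp add: seg_def)
  next
    fix d assume "d \<in> seg 1 (k - 2)"
    then obtain j where j: "1 \<le> j" "j < k - 2" "d = {c j, c (Suc j)}" by (rule segE)
    then show "d \<in> {d \<in> seg 1 (k - 1). c (k - 1) \<notin> d}" using B[of j] by (simp add: seg_def)
  qed
  then show "{d \<in> seg 1 (k - 1) \<union> F. c (k - 1) \<notin> d} = seg 1 (k - 2) \<union> F" using ends(2) by blast
qed

text \<open>All four hub edges are deleted from the full edge set. After multiplication by 4^(i+1)
  each leaves 4^i/2 times a matching sum; the two sums from cycle edges coincide and make the
  integer 4^i \<open>K1\<close>. Every term except the half sum for the pendant edges is then known
  to be integral, and \<open>seg_unwind\<close> removes the remaining stretch of the cycle.\<close>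

lemma L_int_2: "4 ^ i * (Ksum E (trimmed v 2) i + Ksum E (trimmed w 2) i) / 2 \<in> \<int>"
proof (rule seg_unwind[OF trimmed_subset trimmed_subset])
  fix i
  let ?Q = "seg 1 (k - 1) \<union> F"
  define Kv where "Kv = Ksum E (seg 1 (k - 1) \<union> trimmed v 2) i"
  define Kw where "Kw = Ksum E (seg 1 (k - 1) \<union> trimmed w 2) i"
  define K1 where "K1 = Ksum E (seg 1 (k - 2) \<union> F) i"
  have ne: "v 1 \<noteq> c 0" "w 1 \<noteq> c 0" "v 1 \<noteq> c 1" "v 1 \<noteq> c (k - 1)" "w 1 \<noteq> c 1" "w 1 \<noteq> c (k - 1)"
    using v1(2) w1(2) k3 by auto
  have ne': "c 1 \<noteq> c 0" "c (k - 1) \<noteq> c 0" "c 1 \<noteq> c (k - 1)" using k3 by (simp_all add: c_eq)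
  have deg: "deg E (v 1) = 2" "deg E (w 1) = 2" "deg E (c 1) = 2" "deg E (c (k - 1)) = 2"
    using deg_v[of 1] deg_w[of 1] t2 deg_i[of 1] deg_i[of "k - 1"] k3 by simp_all
  have "Ksum E E (Suc i) = Ksum E (hub_edges \<union> ?Q) (Suc i)"
    by (subst edges_decomposition) (simp only: Un_assoc)
  also have "\<dots> = Ksum E ({{c 0, w 1}, {c 0, c 1}, {c 0, c (k - 1)}} \<union> ?Q) (Suc i) + 1 / 8 * Kv"
    unfolding Kv_def avoid_path[OF pendant_v, symmetric]
    by (rule delete_hub_edge) (use ne vw1 deg in \<open>auto simp: doubleton_eq_iff\<close>)
  also have "Ksum E ({{c 0, w 1}, {c 0, c 1}, {c 0, c (k - 1)}} \<union> ?Q) (Suc i)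
      = Ksum E ({{c 0, c 1}, {c 0, c (k - 1)}} \<union> ?Q) (Suc i) + 1 / 8 * Kw"
    unfolding Kw_def avoid_path[OF pendant_w, symmetric]
    by (rule delete_hub_edge) (use ne deg in \<open>auto simp: doubleton_eq_iff\<close>)
  also have "Ksum E ({{c 0, c 1}, {c 0, c (k - 1)}} \<union> ?Q) (Suc i)
      = Ksum E ({{c 0, c (k - 1)}} \<union> ?Q) (Suc i) + 1 / 8 * Ksum E (seg 2 (k - 1) \<union> F) i"
    unfolding avoid_cycle_ends[symmetric]
    by (rule delete_hub_edge) (use ne' deg in \<open>auto simp: doubleton_eq_iff\<close>)
  also have "Ksum E ({{c 0, c (k - 1)}} \<union> ?Q) (Suc i) = Ksum E ({} \<union> ?Q) (Suc i) + 1 / 8 * K1"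
    unfolding K1_def avoid_cycle_ends[symmetric]
    by (rule delete_hub_edge) (use ne' deg in auto)
  \<comment> \<open>Both stretches have k - 3 edges and are mirror images; only this length
    matters.\<close>
  also have "Ksum E (seg 2 (k - 1) \<union> F) i = K1"
  proof -
    have "2 + (k - 3) = k - 1" "1 + (k - 3) = k - 2" using k3 by simp_all
    then show ?thesis using seg_shift[OF subset_refl, of 2 "k - 3" i] k3 unfolding K1_def by simp
  qed
  finally have "4 ^ Suc i * Ksum E E (Suc i)
      = 4 ^ Suc i * Ksum E ?Q (Suc i) + 4 ^ i * K1 + 4 ^ i * (Kv + Kw) / 2"
    by (simp add: algebra_simps)
  moreover have "4 ^ i * K1 \<in> \<int>"
  proof -
    have "1 + (k - 3) = k - 2" using k3 by simp
    then show ?thesis using seg_int[OF subset_refl Ksum_F_int, of "k - 3" i] k3 unfolding K1_def by simp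
  qed
  moreover have "4 ^ Suc i * Ksum E ?Q (Suc i) \<in> \<int>"
  proof -
    have "1 + (k - 2) = k - 1" using k3 by simp
    then show ?thesis using seg_int[OF subset_refl Ksum_F_int, of "k - 2" "Suc i"] k3 by simp
  qed
  ultimately have "4 ^ i * (Kv + Kw) / 2
      = 4 ^ Suc i * Ksum E E (Suc i) - 4 ^ Suc i * Ksum E ?Q (Suc i) - 4 ^ i * K1"
    and "4 ^ i * K1 \<in> \<int>" "4 ^ Suc i * Ksum E ?Q (Suc i) \<in> \<int>" by simp_all
  then show "4 ^ i * (Ksum E (seg 1 (k - 1) \<union> trimmed v 2) i
      + Ksum E (seg 1 (k - 1) \<union> trimmed w 2) i) / 2 \<in> \<int>"
    unfolding Kv_def[symmetric] Kw_def[symmetric] using Ksum_E_int[of "Suc i"] by (metis Ints_diff)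
qed

text \<open>The trimming recursion is solved for its last term: the value at \<open>s + 2\<close>
  and order \<open>i\<close> comes from those at \<open>s\<close> and \<open>s + 1\<close> and order
  \<open>i + 1\<close>, so the order is kept arbitrary. At \<open>r = 1\<close> both sums are taken
  over \<open>F\<close> and the half cancels; \<open>r = 2\<close> needs the hub.\<close>

lemma L_int:
  "1 \<le> r \<Longrightarrow> r \<le> t \<Longrightarrow> 4 ^ i * (Ksum E (trimmed v r) i + Ksum E (trimmed w r) i) / 2 \<in> \<int>"
proof (induction r arbitrary: i rule: less_induct)
  case (less r)
  consider "r = 1" | "r = 2" | s where "r = Suc (Suc s)" "1 \<le> s"
  proof -
    have "r = 1 \<or> r = 2 \<or> (r = Suc (Suc (r - 2)) \<and> 1 \<le> r - 2)" using less.prems(1) by arith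
    then show ?thesis using that by metis
  qed
  then show ?case
  proof cases
    case 1
    then show ?thesis using Ksum_F_int[of i] trimmed_1[of v] trimmed_1[of w] by simp
  next
    case 2
    then show ?thesis using L_int_2 by simp
  next
    case 3
    have s: "Suc (Suc s) \<le> t" using 3 less.prems by simp
    have A: "4 ^ Suc i * (Ksum E (trimmed v s) (Suc i) + Ksum E (trimmed w s) (Suc i)) / 2 \<in> \<int>"
      using less.IH[of s "Suc i"] 3 less.prems by simp
    have B: "4 ^ Suc i * (Ksum E (trimmed v (Suc s)) (Suc i) + Ksum E (trimmed w (Suc s)) (Suc i)) / 2 \<in> \<int>"
      using less.IH[of "Suc s" "Suc i"] 3 less.prems by simp
    have eq: "4 ^ i * (Ksum E (trimmed v r) i + Ksum E (trimmed w r) i) / 2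
        = 4 ^ Suc i * (Ksum E (trimmed v s) (Suc i) + Ksum E (trimmed w s) (Suc i)) / 2
        - 4 ^ Suc i * (Ksum E (trimmed v (Suc s)) (Suc i) + Ksum E (trimmed w (Suc s)) (Suc i)) / 2"
      using trimmed_recursion[OF pendant_v 3(2) s, of i] trimmed_recursion[OF pendant_w 3(2) s, of i]
      unfolding 3(1) by (simp add: algebra_simps)
    show ?thesis unfolding eq by (rule Ints_diff[OF A B])
  qed
qed

end

section \<open>From powers of 4 to the stated powers of 2, including small \<open>t\<close>\<close>

lemma two_powi: "(2::real) powi (2 * int n - 1) = 4 ^ n / 2"
proof -
  have "(2::real) powi (2 * int n) = (2 powi 2) powi int n" by (rule power_int_mult)
  then have "(2::real) powi (2 * int n) = 4 ^ n" by simp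
  then show ?thesis by (simp add: power_int_diff)
qed

lemma connected_graph_neighbour:
  assumes "connected_graph V E" "x \<in> V" "z \<in> V" "x \<noteq> z"
  shows "\<exists>y. adj E x y"
proof -
  have "(adj E)\<^sup>*\<^sup>* x z" using assms by (simp add: connected_graph_def)
  then show ?thesis using assms(4) by (cases rule: converse_rtranclpE) blast+
qed

theorem theorem3p7:
  fixes V :: "'a set" and E :: "'a set set" and k t :: nat
    and c v w :: "nat \<Rightarrow> 'a"
  assumes k: "k \<ge> 3" "odd k"
    and G: "odd_unicycle V E"
    and per: "grover_periodic E" "odd (grover_period E)"
    and cyc_V: "\<forall>i<k. c i \<in> V"
    and cyc_inj: "inj_on c {..<k}"
    and cyc_E: "\<forall>i<k. {c i, c (Suc i mod k)} \<in> E"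
    and deg_u: "deg E (c 0) = 4"
    and deg_ui: "\<forall>i. 1 \<le> i \<and> i \<le> k - 1 \<longrightarrow> deg E (c i) = 2"
    and v0: "v 0 = c 0" and w0: "w 0 = c 0"
    and v1: "adj E (c 0) (v 1)" "v 1 \<notin> c ` {..<k}"
    and w1: "adj E (c 0) (w 1)" "w 1 \<notin> c ` {..<k}"
    and vw1: "v 1 \<noteq> w 1"
    and t: "t \<ge> 1"
    and v_rec: "\<forall>j. 2 \<le> j \<and> j \<le> t \<longrightarrow> adj E (v (j - 1)) (v j) \<and> v j \<noteq> v (j - 2)"
    and w_rec: "\<forall>j. 2 \<le> j \<and> j \<le> t \<longrightarrow> adj E (w (j - 1)) (w j) \<and> w j \<noteq> w (j - 2)"
    and deg_v: "\<forall>j. 1 \<le> j \<and> j \<le> t \<longrightarrow> deg E (v j) = 2"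
    and deg_w: "\<forall>j. 1 \<le> j \<and> j \<le> t \<longrightarrow> deg E (w j) = 2"
  shows "\<forall>i. 1 \<le> i \<and> i \<le> t \<longrightarrow>
      (2::real) ^ (2 * i) * Kc E (c ` {..<k}) i \<in> \<int> \<and>
      (2::real) powi (2 * (int i - 1) - 1) * Lpath E (c ` {..<k}) v w 2 (i - 1) \<in> \<int> \<and>
      (\<forall>j. 2 \<le> j \<and> j \<le> i - 1 \<longrightarrow>
         (2::real) powi (2 * (int i - int j) - 1) * Lpath E (c ` {..<k}) v w (j + 1) (i - j) \<in> \<int>)"
proof -
  have G': "simple_graph V E" "connected_graph V E" "card V = card E"
    using G by (simp_all add: odd_unicycle_def)
  \<comment> \<open>Two distinct vertices ensure that every vertex has some other vertex to be
    connected to, and hence a neighbour.\<close>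
  have "c 0 \<noteq> c 1" using cyc_inj k(1) by (simp add: inj_on_eq_iff)
  moreover have "c 0 \<in> V" "c 1 \<in> V" using cyc_V k(1) by simp_all
  ultimately have nbr: "\<exists>y. adj E x y" if "x \<in> V" for x
    using connected_graph_neighbour[OF G'(2) that] by (cases "x = c 0") blast+
  interpret periodic_unicycle V E k c
    by unfold_locales (use k G' cyc_V cyc_inj cyc_E per(1) nbr deg_u deg_ui in simp_all)
  have fin: "finite (F - X)" for X by (rule finite_F_sub) blast
  \<comment> \<open>For \<open>t = 1\<close> nothing is assumed about \<open>v 2\<close> and
    \<open>w 2\<close>, and only order 0 occurs in the claims. There both sums equal 1 whatever
    edges are removed, and 2 powi (-1) times 2 is 1.\<close>
  have L_int: "(2::real) powi (2 * int n - 1) * Lpath E (c ` {..<k}) v w r n \<in> \<int>"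
    if r: "1 \<le> r" and rt: "n = 0 \<or> r \<le> t \<and> 2 \<le> t" for n r
  proof (cases "n = 0")
    case True
    then show ?thesis by (simp add: Lpath_def Kpath_def Ksum_0[OF fin] two_powi[of 0, simplified])
  next
    case False
    then have "r \<le> t" "2 \<le> t" using rt by simp_all
    interpret pendant_paths V E k c v w t
      by unfold_locales (use v0 w0 v1 w1 vw1 v_rec w_rec deg_v deg_w \<open>2 \<le> t\<close> in simp_all)
    show ?thesis
      using L_int[OF r \<open>r \<le> t\<close>, of n] unfolding two_powi Lpath_def Kpath_def trimmed_def by simp
  qed
  show ?thesis
  proof (intro allI impI conjI)
    fix i assume i: "1 \<le> i \<and> i \<le> t"
    show "(2::real) ^ (2 * i) * Kc E (c ` {..<k}) i \<in> \<int>"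
      using Ksum_F_int[of i] by (simp add: Kc_def power_mult)
    have i1: "int i - 1 = int (i - 1)" using i by simp
    \<comment> \<open>A positive order \<open>i - 1\<close> forces \<open>i \<ge> 2\<close>, so the
      second path edges exist.\<close>
    have "i - 1 = 0 \<or> 2 \<le> t \<and> 2 \<le> t" using i by arith
    then show "(2::real) powi (2 * (int i - 1) - 1) * Lpath E (c ` {..<k}) v w 2 (i - 1) \<in> \<int>"
      unfolding i1 by (intro L_int) simp_all
    fix j assume j: "2 \<le> j \<and> j \<le> i - 1"
    then have ij: "int i - int j = int (i - j)" and jt: "1 \<le> j + 1" "j + 1 \<le> t \<and> 2 \<le> t"
      using i by linarith+
    show "(2::real) powi (2 * (int i - int j) - 1) * Lpath E (c ` {..<k}) v w (j + 1) (i - j) \<in> \<int>"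
      unfolding ij by (rule L_int[OF jt(1) disjI2[OF jt(2)]])
  qed
qed

end
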